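(* Let $L$ be a domain and $V^c_{\le1}(L)$ the set of sups in $\mathcal{V}_{\le1}(L)$ of directed subsets of $\{\nu:\nu\text{ a simple valuation in }\mathcal{V}_{\le1}(L),\ \nu\le\delta_y\text{ for some }y\in L\}$, equipped with the order and operations induced from $\mathcal{V}_{\le1}(L)$ (so that it is a consistent kegelspitze), and let $\eta^c_L:L\to V^c_{\le1}(L)$, $x\mapsto\delta_x$. Then $V^c_{\le1}(L)$ is the free consistent kegelspitze over $L$: for every consistent kegelspitze $K$ and every Scott continuous map $f:L\to K$ there is a unique homomorphism of consistent kegelspitzen $\hat{f}:V^c_{\le1}(L)\to K$ with $\hat{f}\circ\eta^c_L=f$.
   Context: For a domain $L$, a valuation is a map $\mu$ from the Scott open subsets of $L$ to $\overline{\mathbb{R}}_{\ge0}$ with $\mu(\emptyset)=0$, monotone, and $\mu(U)+\mu(V)=\mu(U\cup V)+\mu(U\cap V)$; it is continuous if Scott continuous. $\mathcal{V}_{\le1}(L)$ is the set of continuous valuations with values $\le1$, ordered pointwise. Operations on $\mathcal{V}_{\le1}(L)$: $\mu_1+_r\mu_2=r\mu_1+(1-r)\mu_2$ for $r\in[0,1]$, scalar multiplication $(r\mu)(U)=r\mu(U)$ for $r\in[0,1]$, and the zero valuation $\underline{0}$. The Dirac valuation $\delta_x$ takes value $1$ on opens containing $x$ and $0$ otherwise; simple valuations are finite sums $\sum_i r_i\delta_{x_i}$, $r_i\ge0$. A consistent kegelspitze is a dcpo $K$ with an element $\underline{0}$, for each $r\in[0,1]$ a partial binary operation $+_r$ defined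 exactly on pairs having a common upper bound in $K$ and partially Scott continuous (commuting with sups of directed sets of such pairs whose sup is such a pair), and a Scott continuous map $[0,1]\times K\to K$, $(r,x)\mapsto rx$, such that every equation or inequation deducible (together with monotonicity of operations) from the laws $x+_1y=x$, $x+_rx=x$, $x+_ry=y+_{1-r}x$, $(x+_ry)+_sz=x+_{rs}(y+_{\frac{r-rs}{1-rs}}z)$, $rx=x+_r\underline{0}$, $0x=\underline{0}=r\underline{0}$, $1x=x$, $(rs)x=r(sx)$, $r(x+_sy)=rx+_sry$ holds whenever every occurrence of each $+_r$ is applied to a pair with a common upper bound. A homomorphism of consistent kegelspitzen is a Scott continuous map $h$ with $h(\underline{0})=\underline{0}$, $h(rx)=rh(x)$, and $h(x+_ry)=h(x)+_rh(y)$ whenever $x,y$ have a common upper bound.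
   Formalization: The associativity law is used with inner weight (s-rs)/(1-rs), for rs<1, instead of the printed (r-rs)/(1-rs), which fails in the consistent valuations and collapses every kegelspitze to a point; L is taken nonempty, since for empty L the set of consistent valuations has no zero. *)

theory Defs
  imports "HOL-Analysis.Analysis"
begin

section \<open>Directed suprema and Scott continuity\<close>

text \<open>Posets are given by a carrier \<open>A\<close> and a relation \<open>le\<close>, because the kegelspitze built
  below is a subset of a function type. Directed sets are non-empty.\<close>

definition directed_set :: "('a \<Rightarrow> 'a \<Rightarrow> bool) \<Rightarrow> 'a set \<Rightarrow> bool" where
  "directed_set le D \<longleftrightarrow> D \<noteq> {} \<and> (\<forall>x\<in>D. \<forall>y\<in>D. \<exists>z\<in>D. le x z \<and> le y z)"

definition is_sup :: "'a set \<Rightarrow> ('a \<Rightarrow> 'a \<Rightarrow> bool) \<Rightarrow> 'a set \<Rightarrow> 'a \<Rightarrow> bool" where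
  "is_sup A le D s \<longleftrightarrow>
     s \<in> A \<and> (\<forall>x\<in>D. le x s) \<and> (\<forall>u\<in>A. (\<forall>x\<in>D. le x u) \<longrightarrow> le s u)"

definition is_dcpo :: "'a set \<Rightarrow> ('a \<Rightarrow> 'a \<Rightarrow> bool) \<Rightarrow> bool" where
  "is_dcpo A le \<longleftrightarrow>
     reflp_on A le \<and> transp_on A le \<and> antisymp_on A le \<and>
     (\<forall>D\<subseteq>A. directed_set le D \<longrightarrow> (\<exists>s. is_sup A le D s))"

definition scott_continuous ::
  "'a set \<Rightarrow> ('a \<Rightarrow> 'a \<Rightarrow> bool) \<Rightarrow> 'b set \<Rightarrow> ('b \<Rightarrow> 'b \<Rightarrow> bool) \<Rightarrow> ('a \<Rightarrow> 'b) \<Rightarrow> bool" where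
  "scott_continuous A leA B leB f \<longleftrightarrow>
     f \<in> A \<rightarrow> B \<and>
     (\<forall>D s. D \<subseteq> A \<longrightarrow> directed_set leA D \<longrightarrow> is_sup A leA D s \<longrightarrow> is_sup B leB (f ` D) (f s))"

definition prod_le :: "('a \<Rightarrow> 'a \<Rightarrow> bool) \<Rightarrow> ('b \<Rightarrow> 'b \<Rightarrow> bool) \<Rightarrow> 'a \<times> 'b \<Rightarrow> 'a \<times> 'b \<Rightarrow> bool" where
  "prod_le leA leB p q \<longleftrightarrow> leA (fst p) (fst q) \<and> leB (snd p) (snd q)"


section \<open>Domains\<close>

text \<open>A domain is a continuous dcpo; no least element is required.\<close>

definition (in order) way_below :: "'a \<Rightarrow> 'a \<Rightarrow> bool" where
  "way_below x y \<longleftrightarrow>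
     (\<forall>D s. directed_set (\<le>) D \<longrightarrow> is_sup UNIV (\<le>) D s \<longrightarrow> y \<le> s \<longrightarrow> (\<exists>d\<in>D. x \<le> d))"

class continuous_dcpo = order +
  assumes dcpo: "is_dcpo UNIV (\<le>)"
    and directed_way_below: "directed_set (\<le>) {y. way_below y x}"
    and sup_way_below: "is_sup UNIV (\<le>) {y. way_below y x} x"

definition scott_open :: "'a::order set \<Rightarrow> bool" where
  "scott_open U \<longleftrightarrow>
     (\<forall>x\<in>U. \<forall>y. x \<le> y \<longrightarrow> y \<in> U) \<and>
     (\<forall>D s. directed_set (\<le>) D \<longrightarrow> is_sup UNIV (\<le>) D s \<longrightarrow> s \<in> U \<longrightarrow> (\<exists>d\<in>D. d \<in> U))"


section \<open>Continuous valuations\<close>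

text \<open>A valuation is a function on Scott open sets. As HOL functions are total, it is given the
  value \<open>0\<close> on all other sets; with this normalisation equality, the pointwise order and the
  pointwise operations on valuations are those of the function type.\<close>

definition valuation :: "('a::order set \<Rightarrow> ennreal) \<Rightarrow> bool" where
  "valuation \<mu> \<longleftrightarrow>
     (\<forall>U. \<not> scott_open U \<longrightarrow> \<mu> U = 0) \<and>
     \<mu> {} = 0 \<and>
     (\<forall>U V. scott_open U \<longrightarrow> scott_open V \<longrightarrow> U \<subseteq> V \<longrightarrow> \<mu> U \<le> \<mu> V) \<and>
     (\<forall>U V. scott_open U \<longrightarrow> scott_open V \<longrightarrow> \<mu> U + \<mu> V = \<mu> (U \<union> V) + \<mu> (U \<inter> V))"

definition continuous_valuation :: "('a::order set \<Rightarrow> ennreal) \<Rightarrow> bool" where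
  "continuous_valuation \<mu> \<longleftrightarrow>
     valuation \<mu> \<and> scott_continuous (Collect scott_open) (\<subseteq>) UNIV (\<le>) \<mu>"

definition subprob_vals :: "('a::order set \<Rightarrow> ennreal) set" where
  "subprob_vals = {\<mu>. continuous_valuation \<mu> \<and> (\<forall>U. scott_open U \<longrightarrow> \<mu> U \<le> 1)}"

definition dirac :: "'a::order \<Rightarrow> 'a set \<Rightarrow> ennreal" where
  "dirac x U = (if scott_open U \<and> x \<in> U then 1 else 0)"

definition simple_valuation :: "('a::order set \<Rightarrow> ennreal) \<Rightarrow> bool" where
  "simple_valuation \<nu> \<longleftrightarrow>
     (\<exists>(n::nat) (r :: nat \<Rightarrow> real) (x :: nat \<Rightarrow> 'a).
        (\<forall>i<n. 0 \<le> r i) \<and> \<nu> = (\<lambda>U. \<Sum>i<n. ennreal (r i) * dirac (x i) U))"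


section \<open>Consistent kegelspitzen\<close>

text \<open>The partial operation \<open>+\<^sub>r\<close> is represented by a total function \<open>kplus\<close>. Its values
  are meaningful only for \<open>r \<in> {0..1}\<close> and for pairs with a common upper bound, and nothing
  below depends on its other values. Likewise \<open>kscale\<close> matters only for \<open>r \<in> {0..1}\<close>.\<close>

record 'k kegelspitze =
  kcarrier :: "'k set"
  kle :: "'k \<Rightarrow> 'k \<Rightarrow> bool"
  kzero :: 'k
  kplus :: "real \<Rightarrow> 'k \<Rightarrow> 'k \<Rightarrow> 'k"
  kscale :: "real \<Rightarrow> 'k \<Rightarrow> 'k"

definition consistent_pair :: "'k kegelspitze \<Rightarrow> 'k \<Rightarrow> 'k \<Rightarrow> bool" where
  "consistent_pair K x y \<longleftrightarrow>
     x \<in> kcarrier K \<and> y \<in> kcarrier K \<and> (\<exists>z\<in>kcarrier K. kle K x z \<and> kle K y z)"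

datatype kterm = KVar nat | KZero | KPlus real kterm kterm | KScale real kterm

text \<open>The laws are schematic in the terms \<open>x\<close>, \<open>y\<close>, \<open>z\<close>. In the associativity law both sides denote
  \<open>rs x + s(1 - r) y + (1 - s) z\<close>, so the inner weight on the right is \<open>(s - rs)/(1 - rs)\<close>; it
  needs \<open>rs \<noteq> 1\<close>.\<close>

inductive kegel_law :: "kterm \<Rightarrow> kterm \<Rightarrow> bool" where
  plus_one: "kegel_law (KPlus 1 x y) x"
| plus_idem: "r \<in> {0..1} \<Longrightarrow> kegel_law (KPlus r x x) x"
| plus_comm: "r \<in> {0..1} \<Longrightarrow> kegel_law (KPlus r x y) (KPlus (1 - r) y x)"
| plus_assoc: "r \<in> {0..1} \<Longrightarrow> s \<in> {0..1} \<Longrightarrow> r * s < 1 \<Longrightarrow>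
    kegel_law (KPlus s (KPlus r x y) z)
              (KPlus (r * s) x (KPlus ((s - r * s) / (1 - r * s)) y z))"
| scale_eq_plus: "r \<in> {0..1} \<Longrightarrow> kegel_law (KScale r x) (KPlus r x KZero)"
| zero_scale: "kegel_law (KScale 0 x) KZero"
| scale_zero: "r \<in> {0..1} \<Longrightarrow> kegel_law (KScale r KZero) KZero"
| one_scale: "kegel_law (KScale 1 x) x"
| scale_scale: "r \<in> {0..1} \<Longrightarrow> s \<in> {0..1} \<Longrightarrow>
    kegel_law (KScale (r * s) x) (KScale r (KScale s x))"
| scale_plus: "r \<in> {0..1} \<Longrightarrow> s \<in> {0..1} \<Longrightarrow>
    kegel_law (KScale r (KPlus s x y)) (KPlus s (KScale r x) (KScale r y))"

text \<open>Deducibility of inequations. The operations are monotone in their term arguments, and scalar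
  multiplication, being an operation on \<open>[0,1] \<times> K\<close>, also in the scalar. An equation \<open>t = u\<close> is
  deducible iff both \<open>t \<le> u\<close> and \<open>u \<le> t\<close> are, so its validity in a poset is covered by that of
  deducible inequations.\<close>

inductive deducible_le :: "kterm \<Rightarrow> kterm \<Rightarrow> bool" where
  law: "kegel_law t u \<Longrightarrow> deducible_le t u"
| law_sym: "kegel_law t u \<Longrightarrow> deducible_le u t"
| refl: "deducible_le t t"
| trans: "deducible_le t u \<Longrightarrow> deducible_le u v \<Longrightarrow> deducible_le t v"
| plus_mono: "r \<in> {0..1} \<Longrightarrow> deducible_le t t' \<Longrightarrow> deducible_le u u' \<Longrightarrow>
    deducible_le (KPlus r t u) (KPlus r t' u')"
| scale_mono: "r \<in> {0..1} \<Longrightarrow> s \<in> {0..1} \<Longrightarrow> r \<le> s \<Longrightarrow> deducible_le t t' \<Longrightarrow>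
    deducible_le (KScale r t) (KScale s t')"

primrec keval :: "'k kegelspitze \<Rightarrow> (nat \<Rightarrow> 'k) \<Rightarrow> kterm \<Rightarrow> 'k" where
  "keval K \<rho> (KVar n) = \<rho> n"
| "keval K \<rho> KZero = kzero K"
| "keval K \<rho> (KPlus r t u) = kplus K r (keval K \<rho> t) (keval K \<rho> u)"
| "keval K \<rho> (KScale r t) = kscale K r (keval K \<rho> t)"

primrec kdefined :: "'k kegelspitze \<Rightarrow> (nat \<Rightarrow> 'k) \<Rightarrow> kterm \<Rightarrow> bool" where
  "kdefined K \<rho> (KVar n) \<longleftrightarrow> \<rho> n \<in> kcarrier K"
| "kdefined K \<rho> KZero \<longleftrightarrow> True"
| "kdefined K \<rho> (KPlus r t u) \<longleftrightarrow>
     r \<in> {0..1} \<and> kdefined K \<rho> t \<and> kdefined K \<rho> u \<and>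
     consistent_pair K (keval K \<rho> t) (keval K \<rho> u)"
| "kdefined K \<rho> (KScale r t) \<longleftrightarrow> r \<in> {0..1} \<and> kdefined K \<rho> t"

definition partially_scott_continuous :: "'k kegelspitze \<Rightarrow> ('k \<Rightarrow> 'k \<Rightarrow> 'k) \<Rightarrow> bool" where
  "partially_scott_continuous K g \<longleftrightarrow>
     (\<forall>D x y. D \<subseteq> {(a, b). consistent_pair K a b} \<longrightarrow>
        directed_set (prod_le (kle K) (kle K)) D \<longrightarrow>
        is_sup (kcarrier K \<times> kcarrier K) (prod_le (kle K) (kle K)) D (x, y) \<longrightarrow>
        consistent_pair K x y \<longrightarrow>
        is_sup (kcarrier K) (kle K) ((\<lambda>(a, b). g a b) ` D) (g x y))"

locale consistent_kegelspitze =
  fixes K :: "'k kegelspitze"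
  assumes dcpo: "is_dcpo (kcarrier K) (kle K)"
    and zero_closed: "kzero K \<in> kcarrier K"
    and plus_closed: "\<And>r x y. r \<in> {0..1} \<Longrightarrow> consistent_pair K x y \<Longrightarrow> kplus K r x y \<in> kcarrier K"
    and plus_cont: "\<And>r. r \<in> {0..1} \<Longrightarrow> partially_scott_continuous K (kplus K r)"
    and scale_cont: "scott_continuous ({0..1} \<times> kcarrier K) (prod_le (\<le>) (kle K))
                       (kcarrier K) (kle K) (\<lambda>(r, x). kscale K r x)"
    and deducible: "\<And>\<rho> t u. deducible_le t u \<Longrightarrow> kdefined K \<rho> t \<Longrightarrow> kdefined K \<rho> u \<Longrightarrow>
                       kle K (keval K \<rho> t) (keval K \<rho> u)"

definition kegelspitze_hom :: "'k kegelspitze \<Rightarrow> 'l kegelspitze \<Rightarrow> ('k \<Rightarrow> 'l) \<Rightarrow> bool" where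
  "kegelspitze_hom K M h \<longleftrightarrow>
     scott_continuous (kcarrier K) (kle K) (kcarrier M) (kle M) h \<and>
     h (kzero K) = kzero M \<and>
     (\<forall>r\<in>{0..1}. \<forall>x\<in>kcarrier K. h (kscale K r x) = kscale M r (h x)) \<and>
     (\<forall>r\<in>{0..1}. \<forall>x y. consistent_pair K x y \<longrightarrow> h (kplus K r x y) = kplus M r (h x) (h y))"


section \<open>The consistent valuations\<close>

definition consistent_vals :: "('a::order set \<Rightarrow> ennreal) set" where
  "consistent_vals =
     {\<mu>. \<exists>D. D \<subseteq> {\<nu> \<in> subprob_vals. simple_valuation \<nu> \<and> (\<exists>y. \<nu> \<le> dirac y)} \<and>
             directed_set (\<le>) D \<and> is_sup subprob_vals (\<le>) D \<mu>}"

definition Vc :: "('a::order set \<Rightarrow> ennreal) kegelspitze" where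
  "Vc = \<lparr>
     kcarrier = consistent_vals,
     kle = (\<le>),
     kzero = (\<lambda>U. 0),
     kplus = (\<lambda>r \<mu> \<nu> U. ennreal r * \<mu> U + ennreal (1 - r) * \<nu> U),
     kscale = (\<lambda>r \<mu> U. ennreal r * \<mu> U) \<rparr>"

end

theory Submission
  imports Defs
begin

text \<open>A simple valuation below \<open>\<delta>\<^sub>y\<close> is the value of a kegelspitze term \<open>t\<close> at Dirac valuations
  \<open>\<delta>\<^bsub>x n\<^esub>\<close> with \<open>x n \<le> y\<close>. Below an element \<open>f y\<close> of a consistent kegelspitze all operations are
  defined, so \<open>t\<close> also has a value at the elements \<open>f (x n)\<close>, and this is what a homomorphism
  extending \<open>f\<close> must assign to the valuation. The assignment is well defined and monotone: if one
  simple valuation lies below another, Hall's condition holds for the open complements of finitely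
  many principal ideals, hence mass can be transported upwards along pairs \<open>x i \<le> x' j\<close>, and each
  such pair can be split off from the two terms by the laws.

  A simple valuation is the directed supremum of the valuations obtained from it by scaling with
  \<open>s < 1\<close> and replacing each point by one way below it, and these are way below it in the valuations.
  So every consistent valuation is the directed supremum of the simple ones way below it, and the
  assignment extends to all consistent valuations by suprema; the approximation property makes the
  extension Scott continuous.\<close>

section \<open>Directed sets and suprema\<close>

text \<open>The operations of \<open>K\<close> are partial, and \<open>deducible\<close> speaks only
  about pairs of terms that are both defined. The points of one generator therefore stay below a
  single \<open>y\<close>: everything computed from their images then lies below \<open>f y\<close>,
  so any two such values form a consistent pair. Two generators need not have points with a common
  bound. One appears when both are way below one consistent valuation: some generator way below it
  lies above both, and so does a Dirac valuation. In this way an upper bound of two valuations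
  reaches the level of points, both for closure of \<open>consistent_vals\<close> under
  \<open>val_plus\<close> and for additivity of the extension. The laws yield equations between
  terms; the order of the domain enters only through pairs of comparable points. An inequality
  between simple valuations has to be decomposed into such pairs before \<open>K\<close> can follow
  it, which is what the transport of mass achieves.\<close>

lemma directed_setI:
  assumes "D \<noteq> {}" "\<And>x y. x \<in> D \<Longrightarrow> y \<in> D \<Longrightarrow> \<exists>z\<in>D. le x z \<and> le y z"
  shows "directed_set le D"
  using assms unfolding directed_set_def by blast

lemma directed_setD:
  assumes "directed_set le D" "x \<in> D" "y \<in> D"
  obtains z where "z \<in> D" "le x z" "le y z"
  using assms unfolding directed_set_def by blast

lemma directed_set_nonempty: "directed_set le D \<Longrightarrow> D \<noteq> {}"
  unfolding directed_set_def by blast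

lemma directed_set_image:
  assumes "directed_set le E"
    and "\<And>e e'. e \<in> E \<Longrightarrow> e' \<in> E \<Longrightarrow> le e e' \<Longrightarrow> le' (g e) (g e')"
  shows "directed_set le' (g ` E)"
  using assms unfolding directed_set_def by (simp add: ball_simps) meson

lemma directed_set_finite_upper_bound:
  fixes D :: "'a::preorder set"
  assumes "directed_set (\<le>) D" "finite F" "F \<subseteq> D"
  shows "\<exists>z\<in>D. \<forall>x\<in>F. x \<le> z"
  using assms(2,3)
proof (induction F)
  case empty
  then show ?case using directed_set_nonempty[OF assms(1)] by blast
next
  case (insert a F)
  then obtain z where z: "z \<in> D" "\<forall>x\<in>F. x \<le> z" by blast
  obtain w where "w \<in> D" "a \<le> w" "z \<le> w"
    using directed_setD[OF assms(1), of a z] insert.prems z by blast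
  then show ?case using z by (intro bexI[of _ w]) (auto intro: order_trans)
qed

lemma is_sup_unique:
  assumes "antisymp_on A le" "is_sup A le D s" "is_sup A le D s'"
  shows "s = s'"
  using assms unfolding is_sup_def antisymp_on_def by blast

text \<open>Functions into \<open>ennreal\<close> form a complete lattice. As long as the pointwise
  supremum stays in the carrier, it is the relative supremum, so statements about suprema of
  valuations become equations with \<open>Sup\<close>.\<close>

lemma is_sup_Sup_iff:
  fixes D :: "'a::complete_lattice set"
  assumes "Sup D \<in> A"
  shows "is_sup A (\<le>) D s \<longleftrightarrow> s = Sup D"
  using assms unfolding is_sup_def
  by (auto intro: Sup_upper Sup_least antisym)

text \<open>To test one coordinate, keep the other one at its supremum.\<close>

lemma is_sup_prod_iff:
  "is_sup (A \<times> B) (prod_le leA leB) D (a, b) \<longleftrightarrow>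
     is_sup A leA (fst ` D) a \<and> is_sup B leB (snd ` D) b"
proof
  assume s: "is_sup (A \<times> B) (prod_le leA leB) D (a, b)"
  have "leA a u" if "u \<in> A" "\<forall>x\<in>fst ` D. leA x u" for u
    using s that unfolding is_sup_def prod_le_def
    by (metis (no_types, lifting) fst_conv image_eqI mem_Sigma_iff snd_conv)
  moreover have "leB b u" if "u \<in> B" "\<forall>x\<in>snd ` D. leB x u" for u
    using s that unfolding is_sup_def prod_le_def
    by (metis (no_types, lifting) fst_conv image_eqI mem_Sigma_iff snd_conv)
  ultimately show "is_sup A leA (fst ` D) a \<and> is_sup B leB (snd ` D) b"
    using s unfolding is_sup_def prod_le_def by auto
next
  assume "is_sup A leA (fst ` D) a \<and> is_sup B leB (snd ` D) b"
  then show "is_sup (A \<times> B) (prod_le leA leB) D (a, b)"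
    unfolding is_sup_def prod_le_def by auto
qed

lemma scott_continuous_is_sup:
  assumes "scott_continuous A leA B leB f" "D \<subseteq> A" "directed_set leA D" "is_sup A leA D s"
  shows "is_sup B leB (f ` D) (f s)"
  using assms unfolding scott_continuous_def by blast

lemma scott_continuous_closed:
  "scott_continuous A leA B leB f \<Longrightarrow> x \<in> A \<Longrightarrow> f x \<in> B"
  unfolding scott_continuous_def by blast

lemma scott_continuous_mono:
  assumes f: "scott_continuous A leA B leB f" and A: "reflp_on A leA"
    and xy: "x \<in> A" "y \<in> A" "leA x y"
  shows "leB (f x) (f y)"
proof -
  have yy: "leA y y" using A xy by (simp add: reflp_on_def)
  have "directed_set leA {x, y}" "is_sup A leA {x, y} y"
    using xy yy unfolding directed_set_def is_sup_def by auto
  then have "is_sup B leB (f ` {x, y}) (f y)"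
    using f xy by (intro scott_continuous_is_sup) auto
  then show ?thesis unfolding is_sup_def by auto
qed

lemma directed_set_prod:
  assumes "directed_set leA A" "directed_set leB B"
  shows "directed_set (prod_le leA leB) (A \<times> B)"
proof (rule directed_setI)
  show "A \<times> B \<noteq> {}" using directed_set_nonempty[OF assms(1)] directed_set_nonempty[OF assms(2)] by blast
  fix p q assume "p \<in> A \<times> B" "q \<in> A \<times> B"
  then have "fst p \<in> A" "fst q \<in> A" "snd p \<in> B" "snd q \<in> B" by auto
  moreover obtain a where "a \<in> A" "leA (fst p) a" "leA (fst q) a"
    using directed_setD[OF assms(1) calculation(1,2)] by blast
  moreover obtain b where "b \<in> B" "leB (snd p) b" "leB (snd q) b"
    using directed_setD[OF assms(2) calculation(3,4)] by blast
  ultimately show "\<exists>z\<in>A \<times> B. prod_le leA leB p z \<and> prod_le leA leB q z"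
    by (intro bexI[of _ "(a, b)"]) (auto simp: prod_le_def)
qed

lemma directed_set_fst: "directed_set (prod_le leA leB) D \<Longrightarrow> directed_set leA (fst ` D)"
  by (erule directed_set_image) (simp add: prod_le_def)

lemma directed_set_snd: "directed_set (prod_le leA leB) D \<Longrightarrow> directed_set leB (snd ` D)"
  by (erule directed_set_image) (simp add: prod_le_def)

section \<open>Terms and their weights\<close>

text \<open>The purely syntactic part of \<open>kdefined\<close>; in an environment with a common
  bound it already implies definedness.\<close>

primrec wf_term :: "kterm \<Rightarrow> bool" where
  "wf_term (KVar n) \<longleftrightarrow> True"
| "wf_term KZero \<longleftrightarrow> True"
| "wf_term (KPlus r t u) \<longleftrightarrow> r \<in> {0..1} \<and> wf_term t \<and> wf_term u"
| "wf_term (KScale r t) \<longleftrightarrow> r \<in> {0..1} \<and> wf_term t"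

primrec term_vars :: "kterm \<Rightarrow> nat set" where
  "term_vars (KVar n) = {n}"
| "term_vars KZero = {}"
| "term_vars (KPlus r t u) = term_vars t \<union> term_vars u"
| "term_vars (KScale r t) = term_vars t"

text \<open>The subprobability vector denoted by a term: the coefficient of each variable in the
  formal convex combination, with the missing mass sitting at \<open>KZero\<close>.\<close>

primrec weight :: "kterm \<Rightarrow> nat \<Rightarrow> real" where
  "weight (KVar n) = (\<lambda>m. if m = n then 1 else 0)"
| "weight KZero = (\<lambda>m. 0)"
| "weight (KPlus r t u) = (\<lambda>m. r * weight t m + (1 - r) * weight u m)"
| "weight (KScale r t) = (\<lambda>m. r * weight t m)"

text \<open>Serves to move two terms to disjoint sets of variables, so that a single environment can
  interpret both.\<close>

primrec rename :: "(nat \<Rightarrow> nat) \<Rightarrow> kterm \<Rightarrow> kterm" where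
  "rename g (KVar n) = KVar (g n)"
| "rename g KZero = KZero"
| "rename g (KPlus r t u) = KPlus r (rename g t) (rename g u)"
| "rename g (KScale r t) = KScale r (rename g t)"

lemma wf_term_rename [simp]: "wf_term (rename g t) = wf_term t"
  by (induction t) auto

lemma keval_rename [simp]: "keval K \<rho> (rename g t) = keval K (\<lambda>n. \<rho> (g n)) t"
  by (induction t) auto

lemma finite_term_vars [simp]: "finite (term_vars t)"
  by (induction t) auto

lemma weight_not_var: "n \<notin> term_vars t \<Longrightarrow> weight t n = 0"
  by (induction t) auto

lemma weight_nonneg: "wf_term t \<Longrightarrow> 0 \<le> weight t n"
  by (induction t) auto

lemma weight_le_1: "wf_term t \<Longrightarrow> weight t n \<le> 1"
proof (induction t)
  case (KPlus r t u)
  then have "r * weight t n + (1 - r) * weight u n \<le> r * 1 + (1 - r) * 1"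
    by (intro add_mono mult_left_mono) auto
  then show ?case by simp
next
  case (KScale r t)
  then show ?case by (simp add: mult_le_one weight_nonneg)
qed auto

text \<open>Split off the last point and rescale the other weights by the remaining mass
  \<open>1 - p N\<close>. If \<open>p N = 1\<close>, all other weights vanish and a variable
  suffices.\<close>

lemma term_of_weights:
  assumes "\<And>i. i < N \<Longrightarrow> 0 \<le> p i" "(\<Sum>i<N. p i) \<le> 1"
  shows "\<exists>t. wf_term t \<and> term_vars t \<subseteq> {..<N} \<and> (\<forall>i<N. weight t i = p i)"
  using assms
proof (induction N arbitrary: p)
  case 0
  then show ?case by (intro exI[of _ KZero]) auto
next
  case (Suc N)
  let ?a = "p N"
  have sum_ge: "0 \<le> (\<Sum>i<N. p i)" by (rule sum_nonneg) (use Suc.prems in auto)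
  have a: "0 \<le> ?a" "?a \<le> 1" using Suc.prems sum_ge by auto
  show ?case
  proof (cases "?a = 1")
    case True
    then have "(\<Sum>i<N. p i) = 0" using Suc.prems sum_ge by simp
    then have "\<forall>i<N. p i = 0"
      using Suc.prems by (subst (asm) sum_nonneg_eq_0_iff) auto
    then show ?thesis using True
      by (intro exI[of _ "KVar N"]) (auto simp: less_Suc_eq)
  next
    case False
    have "(\<Sum>i<N. p i / (1 - ?a)) = (\<Sum>i<N. p i) / (1 - ?a)"
      by (simp add: sum_divide_distrib)
    also have "\<dots> \<le> 1" using Suc.prems(2) False a by (simp add: field_simps)
    finally obtain t where t: "wf_term t" "term_vars t \<subseteq> {..<N}"
      "\<forall>i<N. weight t i = p i / (1 - ?a)"
      using Suc.IH[of "\<lambda>i. p i / (1 - ?a)"] Suc.prems(1) a by auto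
    have "weight t N = 0" using t(2) by (intro weight_not_var) auto
    then show ?thesis using t a False
      by (intro exI[of _ "KPlus ?a (KVar N) t"]) (auto simp: less_Suc_eq)
  qed
qed

section \<open>Extracting a variable from a term\<close>

text \<open>The weights are carried along so that those of a remainder \<open>t'\<close> can be read
  off from an equation \<open>term_eq t (KPlus a (KVar i) t')\<close>.\<close>

definition term_eq :: "kterm \<Rightarrow> kterm \<Rightarrow> bool" where
  "term_eq t u \<longleftrightarrow> deducible_le t u \<and> deducible_le u t \<and> weight t = weight u"

lemma term_eq_refl [simp]: "term_eq t t"
  by (simp add: term_eq_def deducible_le.refl)

lemma term_eq_sym: "term_eq t u \<Longrightarrow> term_eq u t"
  by (simp add: term_eq_def)

lemma term_eq_trans [trans]: "term_eq t u \<Longrightarrow> term_eq u v \<Longrightarrow> term_eq t v"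
  unfolding term_eq_def by (metis deducible_le.trans)

lemma term_eq_plus:
  "r \<in> {0..1} \<Longrightarrow> term_eq t t' \<Longrightarrow> term_eq u u' \<Longrightarrow> term_eq (KPlus r t u) (KPlus r t' u')"
  unfolding term_eq_def by (simp add: deducible_le.plus_mono)

lemma term_eq_scale:
  "r \<in> {0..1} \<Longrightarrow> term_eq t t' \<Longrightarrow> term_eq (KScale r t) (KScale r t')"
  unfolding term_eq_def by (simp add: deducible_le.scale_mono)

lemma term_eq_law: "kegel_law t u \<Longrightarrow> weight t = weight u \<Longrightarrow> term_eq t u"
  by (simp add: term_eq_def deducible_le.law deducible_le.law_sym)

lemma term_eq_plus_one: "term_eq (KPlus 1 x y) x"
  by (intro term_eq_law kegel_law.plus_one) auto

lemma term_eq_plus_idem: "r \<in> {0..1} \<Longrightarrow> term_eq (KPlus r x x) x"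
  by (intro term_eq_law kegel_law.plus_idem) (auto simp: algebra_simps)

lemma term_eq_plus_comm: "r \<in> {0..1} \<Longrightarrow> term_eq (KPlus r x y) (KPlus (1 - r) y x)"
  by (intro term_eq_law kegel_law.plus_comm) auto

lemma term_eq_plus_zero: "term_eq (KPlus 0 x y) y"
  using term_eq_trans[OF term_eq_plus_comm[of 0 x y]] term_eq_plus_one[of y x] by simp

lemma term_eq_plus_assoc:
  assumes "r \<in> {0..1}" "s \<in> {0..1}" "r * s < 1"
  shows "term_eq (KPlus s (KPlus r x y) z)
          (KPlus (r * s) x (KPlus ((s - r * s) / (1 - r * s)) y z))"
proof (intro term_eq_law kegel_law.plus_assoc assms ext)
  fix m
  let ?q = "(s - r * s) / (1 - r * s)"
  have "(1 - r * s) * ?q = s - r * s" using assms(3) by simp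
  moreover have "(1 - r * s) * (1 - ?q) = 1 - s" using assms(3) by (simp add: field_simps)
  ultimately have "(1 - r * s) * (?q * a + (1 - ?q) * b) = (s - r * s) * a + (1 - s) * b" for a b
    by (simp only: distrib_left mult.assoc[symmetric])
  then show "weight (KPlus s (KPlus r x y) z) m =
    weight (KPlus (r * s) x (KPlus ?q y z)) m"
    unfolding weight.simps by (simp only:) (simp add: algebra_simps)
qed

lemma term_eq_scale_plus: "r \<in> {0..1} \<Longrightarrow> term_eq (KScale r x) (KPlus r x KZero)"
  by (intro term_eq_law kegel_law.scale_eq_plus) auto

lemma term_eq_scale_zero: "r \<in> {0..1} \<Longrightarrow> term_eq (KScale r KZero) KZero"
  by (intro term_eq_law kegel_law.scale_zero) auto

lemma term_eq_zero_scale: "term_eq (KScale 0 x) KZero"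
  by (intro term_eq_law kegel_law.zero_scale) auto

lemma assoc_coeff:
  fixes r s :: real
  assumes "r \<in> {0..1}" "s \<in> {0..1}" "r * s < 1"
  shows "(s - r * s) / (1 - r * s) \<in> {0..1}"
  using assms by (auto simp: field_simps mult_left_le_one_le)

text \<open>This is associativity, except when \<open>a * r = 1\<close>; then both coefficients are
  1 and either side reduces to \<open>x\<close>.\<close>

lemma term_eq_plus_nested_left:
  assumes "r \<in> {0..1}" "a \<in> {0..1}" "wf_term x" "wf_term v" "wf_term u"
  shows "\<exists>v'. wf_term v' \<and> term_eq (KPlus r (KPlus a x v) u) (KPlus (a * r) x v')"
proof (cases "a * r < 1")
  case True
  then show ?thesis using term_eq_plus_assoc[OF assms(2,1)] assoc_coeff[OF assms(2,1)] assms
    by (metis wf_term.simps(3))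
next
  case False
  have "a * r \<le> r" "a * r \<le> a" using assms by (auto simp: mult_left_le mult_left_le_one_le)
  with False have "a = 1" "r = 1" using assms by auto
  then show ?thesis using term_eq_plus_one term_eq_sym term_eq_trans
    by (intro exI[of _ v]) (metis assms(4) mult_1)
qed

text \<open>Associativity read backwards with \<open>x\<close> in both inner positions, followed by
  idempotence: \<open>s\<close> is the total coefficient of \<open>x\<close> and \<open>q\<close>
  the share of the first occurrence. The extreme values of \<open>r\<close> are treated apart,
  because associativity needs \<open>q * s = r < 1\<close> and the quotient needs
  \<open>s > 0\<close>.\<close>

lemma term_eq_plus_nested_right:
  assumes r: "r \<in> {0..1}" and b: "b \<in> {0..1}"
  shows "term_eq (KPlus r x (KPlus b x v)) (KPlus (r + (1 - r) * b) x v)"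
proof -
  consider "r = 1" | "r = 0" | "0 < r" "r < 1" using r by fastforce
  then show ?thesis
  proof cases
    case 1
    then show ?thesis by (simp, metis term_eq_plus_one term_eq_sym term_eq_trans)
  next
    case 2
    then show ?thesis by (simp add: term_eq_plus_zero)
  next
    case 3
    define s where "s = r + (1 - r) * b"
    define q where "q = r / s"
    have "0 \<le> (1 - r) * b" "(1 - r) * b \<le> 1 - r"
      using 3 b mult_left_le[of b "1 - r"] by simp_all
    then have s: "0 < s" "r \<le> s" "s \<le> 1" using 3 unfolding s_def by linarith+
    have q: "q \<in> {0..1}" "q * s = r" using s 3 unfolding q_def by auto
    have "(s - q * s) / (1 - q * s) = b"
      using 3 unfolding q(2) by (simp add: s_def)
    then have "term_eq (KPlus s (KPlus q x x) v) (KPlus r x (KPlus b x v))"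
      using term_eq_plus_assoc[of q s x x v] q s 3 by simp
    moreover have "term_eq (KPlus s (KPlus q x x) v) (KPlus s x v)"
      using s q by (intro term_eq_plus term_eq_plus_idem) auto
    ultimately show ?thesis unfolding s_def[symmetric] by (metis term_eq_sym term_eq_trans)
  qed
qed

text \<open>Associativity brings the \<open>x\<close> of \<open>t\<close> to the front;
  commutativity and associativity bring out the \<open>x\<close> of \<open>u\<close>; then the two
  occurrences are merged. The resulting coefficient is the expected one because
  \<open>(1 - a * r) * (1 - q) = 1 - r\<close>.\<close>

lemma term_eq_extract_plus:
  assumes "r \<in> {0..1}" "wf_term t" "wf_term u"
    and "a \<in> {0..1}" "wf_term t'" "term_eq t (KPlus a x t')"
    and "b \<in> {0..1}" "wf_term u'" "term_eq u (KPlus b x u')" and "wf_term x"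
  shows "\<exists>v. wf_term v \<and> term_eq (KPlus r t u) (KPlus (r * a + (1 - r) * b) x v)"
proof (cases "a * r < 1")
  case True
  define q where "q = (r - a * r) / (1 - a * r)"
  have q: "q \<in> {0..1}" unfolding q_def using assoc_coeff[OF assms(4,1) True] .
  have ar: "a * r \<in> {0..1}" using assms True by auto
  have q1: "1 - q \<in> {0..1}" using q by auto
  have b1: "b * (1 - q) \<in> {0..1}" using assms q by (auto intro: mult_le_one)
  obtain v where v: "wf_term v" "term_eq (KPlus (1 - q) (KPlus b x u') t') (KPlus (b * (1 - q)) x v)"
    using term_eq_plus_nested_left[OF q1 assms(7) assms(10,8,5)] by blast
  have "term_eq (KPlus r t u) (KPlus r (KPlus a x t') u)"
    using assms by (intro term_eq_plus) auto
  also have "term_eq \<dots> (KPlus (a * r) x (KPlus q t' u))"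
    unfolding q_def using assms True by (intro term_eq_plus_assoc) auto
  also have "term_eq \<dots> (KPlus (a * r) x (KPlus (1 - q) u t'))"
    using q ar by (intro term_eq_plus term_eq_plus_comm) auto
  also have "term_eq \<dots> (KPlus (a * r) x (KPlus (1 - q) (KPlus b x u') t'))"
    using q1 ar assms by (intro term_eq_plus) auto
  also have "term_eq \<dots> (KPlus (a * r) x (KPlus (b * (1 - q)) x v))"
    using ar v by (intro term_eq_plus) auto
  also have "term_eq \<dots> (KPlus (a * r + (1 - a * r) * (b * (1 - q))) x v)"
    by (rule term_eq_plus_nested_right[OF ar b1])
  finally have *: "term_eq (KPlus r t u) (KPlus (a * r + (1 - a * r) * (b * (1 - q))) x v)" .
  have "(1 - a * r) * (1 - q) = 1 - r" unfolding q_def using True by (simp add: field_simps)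
  then have "a * r + (1 - a * r) * (b * (1 - q)) = r * a + (1 - r) * b"
    by (simp only: mult.left_commute[of _ b] mult.commute)
  with * v show ?thesis by auto
next
  case False
  have "a * r \<le> r" "a * r \<le> a" using assms by (auto simp: mult_left_le mult_left_le_one_le)
  with False have ar: "a = 1" "r = 1" using assms by auto
  have "term_eq (KPlus r t u) t" using ar term_eq_plus_one by simp
  then have "term_eq (KPlus r t u) (KPlus (r * a + (1 - r) * b) x t')"
    using term_eq_trans[OF _ assms(6)] ar by simp
  with assms(5) show ?thesis by blast
qed

lemma term_eq_extract_all:
  assumes "wf_term t"
  shows "\<exists>t'. wf_term t' \<and> term_eq t (KPlus (weight t n) (KVar n) t')"
  using assms
proof (induction t)
  case (KVar m)
  show ?case
  proof (cases "m = n")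
    case True
    then show ?thesis by (intro exI[of _ KZero]) (simp add: term_eq_plus_one term_eq_sym)
  next
    case False
    then show ?thesis by (intro exI[of _ "KVar m"]) (simp add: term_eq_plus_zero term_eq_sym)
  qed
next
  case KZero
  then show ?case by (intro exI[of _ KZero]) (simp add: term_eq_plus_zero term_eq_sym)
next
  case (KPlus r t u)
  then obtain t' u' where "wf_term t'" "term_eq t (KPlus (weight t n) (KVar n) t')"
    "wf_term u'" "term_eq u (KPlus (weight u n) (KVar n) u')" by auto
  then show ?case using KPlus.prems term_eq_extract_plus[of r t u "weight t n" t' "KVar n" "weight u n" u']
    by (auto simp: weight_nonneg weight_le_1)
next
  case (KScale r t)
  then obtain t' where t': "wf_term t'" "term_eq t (KPlus (weight t n) (KVar n) t')" by auto
  \<comment> \<open>Scaling is a convex combination with \<open>KZero\<close>, which contains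
    \<open>KVar n\<close> with coefficient 0; this reduces the case to the one of
    \<open>KPlus\<close>.\<close>
  have z: "term_eq KZero (KPlus 0 (KVar n) KZero)" by (simp add: term_eq_plus_zero term_eq_sym)
  obtain v where "wf_term v" "term_eq (KPlus r t KZero) (KPlus (r * weight t n + (1 - r) * 0) (KVar n) v)"
    using term_eq_extract_plus[of r t KZero "weight t n" t' "KVar n" 0 KZero] KScale.prems t' z
    by (auto simp: weight_nonneg weight_le_1)
  moreover have "term_eq (KScale r t) (KPlus r t KZero)"
    using KScale.prems by (intro term_eq_scale_plus) auto
  ultimately have "term_eq (KScale r t) (KPlus (weight (KScale r t) n) (KVar n) v)"
    using term_eq_trans by (metis add.right_neutral mult_zero_right weight.simps(4))
  with \<open>wf_term v\<close> show ?case by blast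
qed

lemma term_eq_extract:
  assumes "wf_term t" "0 \<le> a" "a \<le> weight t n"
  shows "\<exists>t'. wf_term t' \<and> term_eq t (KPlus a (KVar n) t')"
proof -
  obtain t' where t': "wf_term t'" "term_eq t (KPlus (weight t n) (KVar n) t')"
    using term_eq_extract_all[OF assms(1)] by blast
  have w: "weight t n \<le> 1" using weight_le_1 assms(1) .
  show ?thesis
  proof (cases "a = 1")
    case True
    then show ?thesis using t' w assms by auto
  next
    case False
    \<comment> \<open>After \<open>a\<close> is split off, mass \<open>1 - a\<close> remains;
      \<open>b\<close> is the rest of the weight of \<open>n\<close> relative to it.\<close>
    define b where "b = (weight t n - a) / (1 - a)"
    have b: "b \<in> {0..1}" "a + (1 - a) * b = weight t n"
      using False assms w unfolding b_def by (auto simp: field_simps)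
    have "term_eq (KPlus a (KVar n) (KPlus b (KVar n) t')) (KPlus (weight t n) (KVar n) t')"
      using term_eq_plus_nested_right[of a b "KVar n" t'] b assms w by auto
    then have "term_eq t (KPlus a (KVar n) (KPlus b (KVar n) t'))"
      using t' term_eq_sym term_eq_trans by blast
    then show ?thesis using t' b by (intro exI[of _ "KPlus b (KVar n) t'"]) auto
  qed
qed

lemma term_eq_KZero:
  assumes "wf_term t" "\<And>n. weight t n = 0"
  shows "term_eq t KZero"
  using assms
proof (induction t)
  case (KVar n)
  from KVar.prems(2)[of n] show ?case by simp
next
  case (KPlus r t u)
  consider "r = 0" | "r = 1" | "0 < r" "r < 1" using KPlus.prems by fastforce
  then show ?case
  proof cases
    case 1
    then show ?thesis using KPlus term_eq_trans[OF term_eq_plus_zero] by simp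
  next
    case 2
    then show ?thesis using KPlus term_eq_trans[OF term_eq_plus_one] by simp
  next
    case 3
    have "weight t n = 0 \<and> weight u n = 0" for n
      using KPlus.prems(2)[of n] 3 KPlus.prems(1)
      by (simp add: add_nonneg_eq_0_iff weight_nonneg)
    then have "term_eq (KPlus r t u) (KPlus r KZero KZero)"
      using KPlus by (intro term_eq_plus) auto
    also have "term_eq \<dots> KZero" using KPlus.prems by (intro term_eq_plus_idem) auto
    finally show ?thesis .
  qed
next
  case (KScale r t)
  show ?case
  proof (cases "r = 0")
    case True
    then show ?thesis by (simp add: term_eq_zero_scale)
  next
    case False
    then have "term_eq (KScale r t) (KScale r KZero)"
      using KScale by (intro term_eq_scale) auto
    also have "term_eq \<dots> KZero" using KScale.prems by (intro term_eq_scale_zero) auto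
    finally show ?thesis .
  qed
qed simp

section \<open>Couplings\<close>

text \<open>The supply-demand theorem. Move as much mass \<open>\<epsilon>\<close> as Hall's condition permits along one
  admissible pair \<open>(i, j)\<close>; then \<open>i\<close> or \<open>j\<close> is used up, or some set \<open>A\<close> has become tight and the
  problem splits into \<open>A\<close> with its neighbours and the complements of both.\<close>

lemma coupling_exists:
  fixes p :: "'i \<Rightarrow> real" and q :: "'j \<Rightarrow> real"
  assumes "finite I" "finite J" "\<And>i. i \<in> I \<Longrightarrow> 0 \<le> p i" "\<And>j. j \<in> J \<Longrightarrow> 0 \<le> q j"
    and "\<And>A. A \<subseteq> I \<Longrightarrow> sum p A \<le> sum q {j \<in> J. \<exists>i\<in>A. R i j}"
  shows "\<exists>\<tau>. (\<forall>i j. 0 \<le> \<tau> i j \<and> (\<tau> i j \<noteq> 0 \<longrightarrow> i \<in> I \<and> j \<in> J \<and> R i j)) \<and>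
     (\<forall>i\<in>I. (\<Sum>j\<in>J. \<tau> i j) = p i) \<and> (\<forall>j\<in>J. (\<Sum>i\<in>I. \<tau> i j) \<le> q j)"
  using assms
proof (induction "card I + card J" arbitrary: I J p q rule: less_induct)
  case less
  note fin = less.prems(1,2)
  note p = less.prems(3) and q = less.prems(4) and hall = less.prems(5)
  let ?N = "\<lambda>A. {j \<in> J. \<exists>i\<in>A. R i j}"
  show ?case
  proof (cases "\<forall>i\<in>I. p i = 0")
    case True
    then show ?thesis using q by (intro exI[of _ "\<lambda>i j. 0"]) auto
  next
    case False
    then obtain i where i: "i \<in> I" "0 < p i" using p by force
    have "0 < sum q (?N {i})" using hall[of "{i}"] i by auto
    then have "\<exists>l\<in>?N {i}. 0 < q l" by (metis (lifting) not_le sum_nonpos)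
    then obtain j where j: "j \<in> J" "R i j" "0 < q j" by auto
    \<comment> \<open>The sets whose Hall inequality loses slack when mass moves from
      \<open>i\<close> to \<open>j\<close>: their supply is unchanged, while the demand of their
      neighbours drops.\<close>
    define F where "F = {A. A \<subseteq> I - {i} \<and> j \<in> ?N A}"
    have finF: "finite F" unfolding F_def using fin by auto
    define \<epsilon> where "\<epsilon> = Min (insert (p i) (insert (q j) ((\<lambda>A. sum q (?N A) - sum p A) ` F)))"
    have \<epsilon>_le: "\<epsilon> \<le> p i" "\<epsilon> \<le> q j" "\<And>A. A \<in> F \<Longrightarrow> \<epsilon> \<le> sum q (?N A) - sum p A"
      unfolding \<epsilon>_def by (rule Min_le; use finF in auto)+
    have "\<epsilon> \<in> insert (p i) (insert (q j) ((\<lambda>A. sum q (?N A) - sum p A) ` F))"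
      unfolding \<epsilon>_def using finF by (intro Min_in) auto
    then consider (full) "\<epsilon> = p i \<or> \<epsilon> = q j" | (tight) A where "A \<in> F" "\<epsilon> = sum q (?N A) - sum p A"
      by blast
    note \<epsilon>_cases = this
    have \<epsilon>0: "0 \<le> \<epsilon>"
      using \<epsilon>_cases
    proof cases
      case full
      then show ?thesis using i j by auto
    next
      case (tight A)
      have "A \<subseteq> I" using tight(1) unfolding F_def by auto
      then show ?thesis using hall tight(2) by simp
    qed
    define p' where "p' = (\<lambda>x. p x - (if x = i then \<epsilon> else 0))"
    define q' where "q' = (\<lambda>x. q x - (if x = j then \<epsilon> else 0))"
    have sum_p': "sum p' A = sum p A - (if i \<in> A then \<epsilon> else 0)" if "finite A" for A
      unfolding p'_def using that by (simp add: sum_subtractf)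
    have sum_q': "sum q' A = sum q A - (if j \<in> A then \<epsilon> else 0)" if "finite A" for A
      unfolding q'_def using that by (simp add: sum_subtractf)
    have p': "0 \<le> p' x" if "x \<in> I" for x using p that \<epsilon>_le unfolding p'_def by auto
    have q': "0 \<le> q' x" if "x \<in> J" for x using q that \<epsilon>_le unfolding q'_def by auto
    have hall': "sum p' A \<le> sum q' (?N A)" if A: "A \<subseteq> I" for A
    proof -
      have fA: "finite A" "finite (?N A)" using A fin finite_subset by auto
      show ?thesis
      proof (cases "i \<in> A")
        case True
        then have "j \<in> ?N A" using j by auto
        then show ?thesis using True hall[OF A] by (simp add: sum_p' sum_q' fA)
      next
        case False
        show ?thesis
        proof (cases "j \<in> ?N A")
          case True
          then have "A \<in> F" using A False unfolding F_def by auto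
          from \<epsilon>_le(3)[OF this] show ?thesis using True False by (simp add: sum_p' sum_q' fA)
        next
          case jA: False
          then show ?thesis using False hall[OF A] by (simp only: sum_p' sum_q' fA if_False)
        qed
      qed
    qed
    let ?C = "\<lambda>I J p q \<tau>. (\<forall>i j. 0 \<le> \<tau> i j \<and> (\<tau> i j \<noteq> 0 \<longrightarrow> i \<in> I \<and> j \<in> J \<and> R i j)) \<and>
      (\<forall>i\<in>I. (\<Sum>j\<in>J. \<tau> i j) = (p i :: real)) \<and> (\<forall>j\<in>J. (\<Sum>i\<in>I. \<tau> i j) \<le> (q j :: real))"
    have "\<exists>\<tau>. ?C I J p' q' \<tau>"
      using \<epsilon>_cases
    proof cases
      case full
      then show ?thesis
      proof
        assume "\<epsilon> = p i"
        then have pi: "p' i = 0" unfolding p'_def by simp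
        have "card (I - {i}) < card I" using fin(1) i(1) by (rule card_Diff1_less)
        then have "\<exists>\<tau>. ?C (I - {i}) J p' q' \<tau>"
          using fin p' q' hall' by (intro less.hyps) auto
        then obtain \<tau> where \<tau>: "?C (I - {i}) J p' q' \<tau>" ..
        have \<tau>i: "\<tau> i k = 0" for k using \<tau> by blast
        then have "(\<Sum>x\<in>I. \<tau> x k) = (\<Sum>x\<in>I - {i}. \<tau> x k)" for k
          using sum.remove[OF fin(1) i(1), of "\<lambda>x. \<tau> x k"] by simp
        then have "?C I J p' q' \<tau>" using \<tau> \<tau>i pi by (metis Diff_iff empty_iff insert_iff sum.neutral)
        then show ?thesis by blast
      next
        assume "\<epsilon> = q j"
        then have qj: "q' j = 0" unfolding q'_def by simp
        have card: "card (J - {j}) < card J" using fin(2) j(1) by (rule card_Diff1_less)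
        have N: "sum q' {l \<in> J - {j}. \<exists>i\<in>A. R i l} = sum q' (?N A)" for A
          using fin qj by (intro sum.mono_neutral_left) auto
        have "\<exists>\<tau>. ?C I (J - {j}) p' q' \<tau>"
        proof (rule less.hyps)
          show "card I + card (J - {j}) < card I + card J" using card by simp
          show "sum p' A \<le> sum q' {l \<in> J - {j}. \<exists>i\<in>A. R i l}" if "A \<subseteq> I" for A
            using hall'[OF that] N by simp
        qed (use fin p' q' in auto)
        then obtain \<tau> where \<tau>: "?C I (J - {j}) p' q' \<tau>" ..
        have \<tau>j: "\<tau> k j = 0" for k using \<tau> by blast
        then have "(\<Sum>x\<in>J. \<tau> k x) = (\<Sum>x\<in>J - {j}. \<tau> k x)" for k
          using sum.remove[OF fin(2) j(1), of "\<lambda>x. \<tau> k x"] by simp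
        then have "?C I J p' q' \<tau>" using \<tau> \<tau>j qj by (metis Diff_iff empty_iff insert_iff order_refl sum.neutral)
        then show ?thesis by blast
      qed
    next
      case (tight A)
      have A: "A \<subseteq> I" "i \<notin> A" "j \<in> ?N A" using tight(1) unfolding F_def by auto
      then have fA: "finite A" "finite (?N A)" using fin finite_subset by auto
      have eq: "sum p' A = sum q' (?N A)"
        using A tight(2) by (simp add: sum_p' sum_q' fA)
      have "A \<noteq> {}" using A by auto
      let ?I = "I - A" and ?J = "J - ?N A"
      \<comment> \<open>Both subproblems are smaller: \<open>i\<close> lies outside
        \<open>A\<close>, and \<open>A\<close> is non-empty because it has the neighbour
        \<open>j\<close>.\<close>
      have cards: "card A < card I" "card (?N A) \<le> card J" "card ?I < card I" "card ?J \<le> card J"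
        using A \<open>A \<noteq> {}\<close> fin i by (auto intro!: psubset_card_mono card_mono)
      have "\<exists>\<tau>. ?C A (?N A) p' q' \<tau>"
      proof (rule less.hyps)
        show "card A + card (?N A) < card I + card J" using cards by simp
        show "sum p' B \<le> sum q' {l \<in> ?N A. \<exists>i\<in>B. R i l}" if "B \<subseteq> A" for B
        proof -
          have "{l \<in> ?N A. \<exists>i\<in>B. R i l} = ?N B" using that by auto
          then show ?thesis using hall'[of B] that A by auto
        qed
      qed (use fA A p' q' in auto)
      then obtain \<tau>1 where \<tau>1: "?C A (?N A) p' q' \<tau>1" ..
      have "\<exists>\<tau>. ?C ?I ?J p' q' \<tau>"
      proof (rule less.hyps)
        show "card ?I + card ?J < card I + card J" using cards by simp
        show "sum p' B \<le> sum q' {l \<in> ?J. \<exists>i\<in>B. R i l}" if B: "B \<subseteq> ?I" for B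
        proof -
          have fB: "finite B" using B fin finite_subset by auto
          \<comment> \<open>Hall's condition for \<open>A \<union> B\<close>, from which the
            equality for the tight set \<open>A\<close> is subtracted, is Hall's condition for
            \<open>B\<close> with the remaining neighbours.\<close>
          have "sum p' A + sum p' B = sum p' (A \<union> B)"
            using fA fB B by (intro sum.union_disjoint[symmetric]) auto
          also have "\<dots> \<le> sum q' (?N (A \<union> B))" using A B by (intro hall') auto
          also have "?N (A \<union> B) = ?N A \<union> {l \<in> ?J. \<exists>i\<in>B. R i l}" by blast
          also have "sum q' \<dots> = sum q' (?N A) + sum q' {l \<in> ?J. \<exists>i\<in>B. R i l}"
            using fin by (intro sum.union_disjoint) auto
          finally show ?thesis using eq by simp
        qed
      qed (use fin p' q' in auto)
      then obtain \<tau>2 where \<tau>2: "?C ?I ?J p' q' \<tau>2" ..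
      have \<tau>10: "\<tau>1 k l = 0" if "k \<notin> A \<or> l \<notin> ?N A" for k l using \<tau>1 that by blast
      have \<tau>20: "\<tau>2 k l = 0" if "k \<notin> ?I \<or> l \<notin> ?J" for k l using \<tau>2 that by blast
      let ?\<tau> = "\<lambda>k l. \<tau>1 k l + \<tau>2 k l"
      have 1: "0 \<le> ?\<tau> k l \<and> (?\<tau> k l \<noteq> 0 \<longrightarrow> k \<in> I \<and> l \<in> J \<and> R k l)" for k l
      proof -
        have "0 \<le> \<tau>1 k l" "0 \<le> \<tau>2 k l" using \<tau>1 \<tau>2 by blast+
        moreover have "\<tau>1 k l \<noteq> 0 \<Longrightarrow> k \<in> I \<and> l \<in> J \<and> R k l" using \<tau>1 A(1) by blast
        moreover have "\<tau>2 k l \<noteq> 0 \<Longrightarrow> k \<in> I \<and> l \<in> J \<and> R k l" using \<tau>2 by blast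
        ultimately show ?thesis by (metis add_0 add_nonneg_nonneg)
      qed
      have sumJ: "(\<Sum>l\<in>J. \<tau>1 k l) = (\<Sum>l\<in>?N A. \<tau>1 k l)" "(\<Sum>l\<in>J. \<tau>2 k l) = (\<Sum>l\<in>?J. \<tau>2 k l)" for k
        by (rule sum.mono_neutral_right; use fin \<tau>10 \<tau>20 in blast)+
      have sumI: "(\<Sum>k\<in>I. \<tau>1 k l) = (\<Sum>k\<in>A. \<tau>1 k l)" "(\<Sum>k\<in>I. \<tau>2 k l) = (\<Sum>k\<in>?I. \<tau>2 k l)" for l
        by (rule sum.mono_neutral_right; use fin A(1) \<tau>10 \<tau>20 in blast)+
      have 2: "(\<Sum>l\<in>J. ?\<tau> k l) = p' k" if "k \<in> I" for k
      proof (cases "k \<in> A")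
        case True
        then have "(\<Sum>l\<in>?N A. \<tau>1 k l) = p' k" "(\<Sum>l\<in>?J. \<tau>2 k l) = 0"
          using \<tau>1 \<tau>20 by auto
        then show ?thesis by (simp only: sum.distrib sumJ)
      next
        case False
        then have "(\<Sum>l\<in>?N A. \<tau>1 k l) = 0" "(\<Sum>l\<in>?J. \<tau>2 k l) = p' k"
          using \<tau>2 \<tau>10 that by auto
        then show ?thesis by (simp only: sum.distrib sumJ)
      qed
      have 3: "(\<Sum>k\<in>I. ?\<tau> k l) \<le> q' l" if "l \<in> J" for l
      proof (cases "l \<in> ?N A")
        case True
        then have "(\<Sum>k\<in>A. \<tau>1 k l) \<le> q' l" "(\<Sum>k\<in>?I. \<tau>2 k l) = 0"
          using \<tau>1 \<tau>20[of _ l] by (blast, intro sum.neutral, blast)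
        then show ?thesis by (simp only: sum.distrib sumI)
      next
        case False
        then have "(\<Sum>k\<in>A. \<tau>1 k l) = 0" "(\<Sum>k\<in>?I. \<tau>2 k l) \<le> q' l"
          using \<tau>2 \<tau>10[of _ l] that by (intro sum.neutral, blast, blast)
        then show ?thesis by (simp only: sum.distrib sumI)
      qed
      show ?thesis
        by (intro exI[of _ ?\<tau>] conjI allI ballI)
          (rule 1[THEN conjunct1] 1[THEN conjunct2] 2 3; assumption)+
    qed
    then obtain \<tau> where \<tau>: "?C I J p' q' \<tau>" ..
    let ?\<tau> = "\<lambda>k l. \<tau> k l + (if k = i \<and> l = j then \<epsilon> else 0)"
    have "(\<Sum>l\<in>J. ?\<tau> k l) = (\<Sum>l\<in>J. \<tau> k l) + (if k = i then \<epsilon> else 0)" for k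
      using fin j by (cases "k = i") (simp_all add: sum.distrib)
    then have 1: "(\<Sum>l\<in>J. ?\<tau> k l) = p k" if "k \<in> I" for k
      using \<tau> that unfolding p'_def by simp
    have "(\<Sum>k\<in>I. ?\<tau> k l) = (\<Sum>k\<in>I. \<tau> k l) + (if l = j then \<epsilon> else 0)" for l
      using fin i by (cases "l = j") (simp_all add: sum.distrib)
    then have 2: "(\<Sum>k\<in>I. ?\<tau> k l) \<le> q l" if "l \<in> J" for l
      using \<tau> that unfolding q'_def by (simp add: le_diff_eq)
    have 3: "0 \<le> ?\<tau> k l \<and> (?\<tau> k l \<noteq> 0 \<longrightarrow> k \<in> I \<and> l \<in> J \<and> R k l)" for k l
      using \<tau> \<epsilon>0 i j by (cases "k = i \<and> l = j") auto
    show ?thesis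
        by (intro exI[of _ ?\<tau>] conjI allI ballI)
          (rule 1 2 3[THEN conjunct1] 3[THEN conjunct2]; assumption)+
  qed
qed

section \<open>Evaluation in a consistent kegelspitze\<close>

text \<open>The bound replaces all bookkeeping of definedness: idempotence keeps every value below
  \<open>b\<close>, so each \<open>+_r\<close> that occurs is applied to a consistent pair.\<close>

definition bounded_env :: "'k kegelspitze \<Rightarrow> (nat \<Rightarrow> 'k) \<Rightarrow> 'k \<Rightarrow> bool" where
  "bounded_env K \<rho> b \<longleftrightarrow> b \<in> kcarrier K \<and> (\<forall>n. \<rho> n \<in> kcarrier K \<and> kle K (\<rho> n) b)"

context consistent_kegelspitze
begin

lemma kle_refl [simp]: "x \<in> kcarrier K \<Longrightarrow> kle K x x"
  using dcpo unfolding is_dcpo_def reflp_on_def by blast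

lemma kle_trans:
  "kle K x y \<Longrightarrow> kle K y z \<Longrightarrow> x \<in> kcarrier K \<Longrightarrow> y \<in> kcarrier K \<Longrightarrow> z \<in> kcarrier K \<Longrightarrow> kle K x z"
  using dcpo unfolding is_dcpo_def transp_on_def by blast

lemma kle_antisym:
  "kle K x y \<Longrightarrow> kle K y x \<Longrightarrow> x \<in> kcarrier K \<Longrightarrow> y \<in> kcarrier K \<Longrightarrow> x = y"
  using dcpo unfolding is_dcpo_def antisymp_on_def by blast

lemma sup_exists: "D \<subseteq> kcarrier K \<Longrightarrow> directed_set (kle K) D \<Longrightarrow> \<exists>s. is_sup (kcarrier K) (kle K) D s"
  using dcpo unfolding is_dcpo_def by blast

lemma sup_unique:
  "is_sup (kcarrier K) (kle K) D s \<Longrightarrow> is_sup (kcarrier K) (kle K) D s' \<Longrightarrow> s = s'"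
  using is_sup_unique[of "kcarrier K" "kle K"] dcpo unfolding is_dcpo_def by metis

lemma plus_is_sup:
  assumes "r \<in> {0..1}" "directed_set (prod_le (kle K) (kle K)) D"
    and "\<And>p. p \<in> D \<Longrightarrow> consistent_pair K (fst p) (snd p)" "consistent_pair K x y"
    and "is_sup (kcarrier K \<times> kcarrier K) (prod_le (kle K) (kle K)) D (x, y)"
  shows "is_sup (kcarrier K) (kle K) ((\<lambda>p. kplus K r (fst p) (snd p)) ` D) (kplus K r x y)"
proof -
  have "D \<subseteq> {(a, b). consistent_pair K a b}" using assms(3) by auto
  then show ?thesis
    using plus_cont[OF assms(1), unfolded partially_scott_continuous_def] assms
    by (simp add: case_prod_unfold)
qed

lemma scale_is_sup:
  assumes "directed_set (prod_le (\<le>) (kle K)) D" "D \<subseteq> {0..1} \<times> kcarrier K"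
    and "is_sup ({0..1} \<times> kcarrier K) (prod_le (\<le>) (kle K)) D (r, x)"
  shows "is_sup (kcarrier K) (kle K) ((\<lambda>p. kscale K (fst p) (snd p)) ` D) (kscale K r x)"
  using scott_continuous_is_sup[OF scale_cont assms(2,1,3)] by (simp add: case_prod_unfold)

lemma consistent_pairI:
  "x \<in> kcarrier K \<Longrightarrow> y \<in> kcarrier K \<Longrightarrow> z \<in> kcarrier K \<Longrightarrow> kle K x z \<Longrightarrow> kle K y z \<Longrightarrow>
     consistent_pair K x y"
  unfolding consistent_pair_def by blast

lemma scale_closed: "r \<in> {0..1} \<Longrightarrow> x \<in> kcarrier K \<Longrightarrow> kscale K r x \<in> kcarrier K"
  using scott_continuous_closed[OF scale_cont, of "(r, x)"] by simp

text \<open>Monotonicity of scalar multiplication in the scalar gives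
  \<open>0 x \<le> 1 x\<close>.\<close>

lemma zero_le: "x \<in> kcarrier K \<Longrightarrow> kle K (kzero K) x"
proof -
  assume x: "x \<in> kcarrier K"
  have "deducible_le (KScale 0 (KVar 0)) (KScale 1 (KVar 0))"
    by (intro deducible_le.scale_mono deducible_le.refl) auto
  then have "deducible_le KZero (KVar 0)"
    by (meson deducible_le.law deducible_le.law_sym deducible_le.trans one_scale zero_scale)
  from deducible[OF this, of "\<lambda>_. x"] x show ?thesis by simp
qed

lemma scale_le: "r \<in> {0..1} \<Longrightarrow> x \<in> kcarrier K \<Longrightarrow> kle K (kscale K r x) x"
proof -
  assume r: "r \<in> {0..1}" and x: "x \<in> kcarrier K"
  have "deducible_le (KScale r (KVar 0)) (KScale 1 (KVar 0))"
    using r by (intro deducible_le.scale_mono deducible_le.refl) auto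
  then have "deducible_le (KScale r (KVar 0)) (KVar 0)"
    by (meson deducible_le.law deducible_le.trans one_scale)
  from deducible[OF this, of "\<lambda>_. x"] r x show ?thesis by simp
qed

text \<open>The monotonicity rule of \<open>deducible_le\<close> compares terms under all
  assignments and says nothing about two given elements. The inequality comes instead from partial
  Scott continuity on a two-element chain.\<close>

lemma plus_mono:
  assumes r: "r \<in> {0..1}" and c: "consistent_pair K x y" "consistent_pair K x' y'"
    and le: "kle K x x'" "kle K y y'"
  shows "kle K (kplus K r x y) (kplus K r x' y')"
proof -
  let ?D = "{(x, y), (x', y')}"
  have mem: "x \<in> kcarrier K" "y \<in> kcarrier K" "x' \<in> kcarrier K" "y' \<in> kcarrier K"
    using c unfolding consistent_pair_def by auto
  have "directed_set (prod_le (kle K) (kle K)) ?D"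
    using mem le by (auto simp: directed_set_def prod_le_def)
  moreover have "is_sup (kcarrier K \<times> kcarrier K) (prod_le (kle K) (kle K)) ?D (x', y')"
    using mem le by (auto simp: is_sup_def prod_le_def)
  ultimately have "is_sup (kcarrier K) (kle K) ((\<lambda>p. kplus K r (fst p) (snd p)) ` ?D) (kplus K r x' y')"
    using c by (intro plus_is_sup[OF r]) auto
  then show ?thesis unfolding is_sup_def by auto
qed

text \<open>Compare with the combination of \<open>b\<close> with itself, which idempotence reduces
  to \<open>b\<close>.\<close>

lemma plus_le:
  assumes r: "r \<in> {0..1}" and "x \<in> kcarrier K" "y \<in> kcarrier K" "b \<in> kcarrier K"
    and "kle K x b" "kle K y b"
  shows "kle K (kplus K r x y) b"
proof -
  have c: "consistent_pair K b b" "consistent_pair K x y" using assms consistent_pairI by auto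
  have "deducible_le (KPlus r (KVar 0) (KVar 0)) (KVar 0)"
    using r by (intro deducible_le.law kegel_law.plus_idem)
  from deducible[OF this, of "\<lambda>_. b"] have "kle K (kplus K r b b) b"
    using assms c by simp
  moreover have "kle K (kplus K r x y) (kplus K r b b)"
    using plus_mono[OF r c(2,1)] assms by simp
  ultimately show ?thesis using kle_trans plus_closed assms c by blast
qed

section \<open>Evaluation of terms below a common bound\<close>

lemma keval_bounded:
  assumes "bounded_env K \<rho> b" "wf_term t"
  shows "kdefined K \<rho> t \<and> keval K \<rho> t \<in> kcarrier K \<and> kle K (keval K \<rho> t) b"
  using assms(2)
proof (induction t)
  case (KVar n)
  then show ?case using assms(1) unfolding bounded_env_def by auto
next
  case KZero
  then show ?case using assms(1) zero_closed zero_le unfolding bounded_env_def by auto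
next
  case (KPlus r t u)
  have b: "b \<in> kcarrier K" using assms(1) unfolding bounded_env_def by auto
  from KPlus have c: "consistent_pair K (keval K \<rho> t) (keval K \<rho> u)"
    using b consistent_pairI by auto
  then show ?case using KPlus b plus_closed[OF _ c] plus_le by auto
next
  case (KScale r t)
  have b: "b \<in> kcarrier K" using assms(1) unfolding bounded_env_def by auto
  from KScale have r: "r \<in> {0..1}" and t: "keval K \<rho> t \<in> kcarrier K" "kle K (keval K \<rho> t) b" by auto
  have "kle K (kscale K r (keval K \<rho> t)) b"
    by (rule kle_trans[OF scale_le[OF r t(1)] t(2) scale_closed[OF r t(1)] t(1) b])
  then show ?case using KScale scale_closed[OF r t(1)] by simp
qed

lemmas keval_closed = keval_bounded[THEN conjunct2, THEN conjunct1]

lemma keval_consistent: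
  assumes "bounded_env K \<rho> b" "wf_term t" "wf_term u"
  shows "consistent_pair K (keval K \<rho> t) (keval K \<rho> u)"
  using keval_bounded[OF assms(1,2)] keval_bounded[OF assms(1,3)] assms(1) consistent_pairI
  unfolding bounded_env_def by blast

text \<open>The axiom \<open>deducible\<close> asks for definedness of the two outer terms only,
  which the bound supplies; the intermediate terms of a derivation may be arbitrary.\<close>

lemma keval_term_eq:
  assumes "bounded_env K \<rho> b" "wf_term t" "wf_term u" "term_eq t u"
  shows "keval K \<rho> t = keval K \<rho> u"
  using assms(4) keval_bounded[OF assms(1,2)] keval_bounded[OF assms(1,3)]
  unfolding term_eq_def by (intro kle_antisym deducible) auto

text \<open>A pair \<open>(i, j)\<close> with \<open>\<tau> i j = a > 0\<close> is removed from the coupling by writing \<open>t\<close> as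
  \<open>KPlus a (KVar i) t'\<close> and \<open>u\<close> as \<open>KPlus a (KVar j) u'\<close>; monotonicity of \<open>+\<^sub>a\<close> then leaves \<open>t'\<close> and \<open>u'\<close>.\<close>

lemma keval_le_of_coupling:
  assumes \<rho>: "bounded_env K \<rho> b" and \<rho>': "bounded_env K \<rho>' b'"
    and fin: "finite I" "finite J"
    and "wf_term t" "wf_term u"
    and "\<And>i. i \<notin> I \<Longrightarrow> weight t i = 0"
    and "\<And>i j. 0 \<le> \<tau> i j" "\<And>i j. \<tau> i j \<noteq> 0 \<Longrightarrow> i \<in> I \<and> j \<in> J \<and> kle K (\<rho> i) (\<rho>' j)"
    and "\<And>i. i \<in> I \<Longrightarrow> (\<Sum>j\<in>J. \<tau> i j) = weight t i"
    and "\<And>j. j \<in> J \<Longrightarrow> (\<Sum>i\<in>I. \<tau> i j) \<le> weight u j"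
  shows "kle K (keval K \<rho> t) (keval K \<rho>' u)"
  using assms(5-)
proof (induction "card {p \<in> I \<times> J. \<tau> (fst p) (snd p) \<noteq> 0}" arbitrary: t u \<tau> rule: less_induct)
  case less
  note wf = less.prems(1,2) and out = less.prems(3) and nonneg = less.prems(4)
    and supp = less.prems(5) and sumI = less.prems(6) and sumJ = less.prems(7)
  let ?S = "\<lambda>\<tau>. {p \<in> I \<times> J. \<tau> (fst p) (snd p) \<noteq> (0::real)}"
  show ?case
  proof (cases "\<exists>i j. \<tau> i j \<noteq> 0")
    case False
    then have "weight t i = 0" for i using sumI[of i] out[of i] by (cases "i \<in> I") auto
    then have "keval K \<rho> t = kzero K"
      using keval_term_eq[OF \<rho> wf(1) _ term_eq_KZero[OF wf(1)]] by simp
    then show ?thesis using zero_le keval_closed[OF \<rho>' wf(2)] by simp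
  next
    case True
    then obtain i j where ij: "\<tau> i j \<noteq> 0" by blast
    then have mem: "i \<in> I" "j \<in> J" and le: "kle K (\<rho> i) (\<rho>' j)" using supp by auto
    define a where "a = \<tau> i j"
    have a0: "0 < a" using ij nonneg[of i j] unfolding a_def by simp
    have "a \<le> (\<Sum>j\<in>J. \<tau> i j)" unfolding a_def
      using fin mem nonneg by (intro member_le_sum) auto
    then have at: "a \<le> weight t i" using sumI mem by simp
    have "a \<le> (\<Sum>i\<in>I. \<tau> i j)" unfolding a_def
      using member_le_sum[of i I "\<lambda>i. \<tau> i j"] fin mem nonneg by auto
    then have au: "a \<le> weight u j" using sumJ mem by force
    have a1: "a \<le> 1" using at weight_le_1[OF wf(1), of i] by linarith
    then have a: "a \<in> {0..1}" using a0 by simp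
    obtain t' where t': "wf_term t'" "term_eq t (KPlus a (KVar i) t')"
      using term_eq_extract[OF wf(1) less_imp_le[OF a0] at] by blast
    obtain u' where u': "wf_term u'" "term_eq u (KPlus a (KVar j) u')"
      using term_eq_extract[OF wf(2) less_imp_le[OF a0] au] by blast
    have evt: "keval K \<rho> t = keval K \<rho> (KPlus a (KVar i) t')"
      using keval_term_eq[OF \<rho> wf(1) _ t'(2)] t'(1) a by simp
    have evu: "keval K \<rho>' u = keval K \<rho>' (KPlus a (KVar j) u')"
      using keval_term_eq[OF \<rho>' wf(2) _ u'(2)] u'(1) a by simp
    show ?thesis
    proof (cases "a = 1")
      case True
      have "keval K \<rho> t = keval K \<rho> (KVar i)"
        using keval_term_eq[OF \<rho> wf(1) _ term_eq_trans[OF t'(2)[unfolded True] term_eq_plus_one]] by simp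
      moreover have "keval K \<rho>' u = keval K \<rho>' (KVar j)"
        using keval_term_eq[OF \<rho>' wf(2) _ term_eq_trans[OF u'(2)[unfolded True] term_eq_plus_one]] by simp
      ultimately show ?thesis using le by simp
    next
      case False
      then have a': "0 < 1 - a" using a1 by simp
      \<comment> \<open>Since \<open>a\<close> is all of \<open>\<tau> i j\<close>, the pair leaves
        the support. The mass left is \<open>1 - a\<close>, so the coupling is renormalised like the
        weights of the remainders \<open>t'\<close> and \<open>u'\<close>.\<close>
      define \<tau>' where "\<tau>' = (\<lambda>k l. (\<tau> k l - (if k = i \<and> l = j then a else 0)) / (1 - a))"
      have wt: "weight t' k = (weight t k - (if k = i then a else 0)) / (1 - a)" for k
        using t'(2) a' unfolding term_eq_def by (simp add: field_simps)
      have wu: "weight u' l = (weight u l - (if l = j then a else 0)) / (1 - a)" for l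
        using u'(2) a' unfolding term_eq_def by (simp add: field_simps)
      have supp': "\<tau> k l \<noteq> 0" if "\<tau>' k l \<noteq> 0" for k l
        using that ij unfolding \<tau>'_def by (auto split: if_splits)
      have "?S \<tau>' \<subset> ?S \<tau>"
      proof
        show "?S \<tau>' \<subseteq> ?S \<tau>" using supp' by auto
        have "(i, j) \<in> ?S \<tau>" "(i, j) \<notin> ?S \<tau>'" using ij mem unfolding \<tau>'_def a_def by auto
        then show "?S \<tau>' \<noteq> ?S \<tau>" by blast
      qed
      then have card: "card (?S \<tau>') < card (?S \<tau>)" using fin by (intro psubset_card_mono) auto
      have "kle K (keval K \<rho> t') (keval K \<rho>' u')"
      proof (rule less.hyps[OF card t'(1) u'(1)])
        show "weight t' k = 0" if "k \<notin> I" for k using out[OF that] that mem wt by auto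
        show "0 \<le> \<tau>' k l" for k l unfolding \<tau>'_def using a' nonneg by (auto simp: a_def)
        show "k \<in> I \<and> l \<in> J \<and> kle K (\<rho> k) (\<rho>' l)" if "\<tau>' k l \<noteq> 0" for k l
          using supp'[OF that] supp by blast
        have "(\<Sum>l\<in>J. \<tau> k l - (if k = i \<and> l = j then a else 0)) =
            (\<Sum>l\<in>J. \<tau> k l) - (if k = i then a else 0)" for k
          using fin mem by (cases "k = i") (simp_all add: sum_subtractf)
        then show "(\<Sum>l\<in>J. \<tau>' k l) = weight t' k" if "k \<in> I" for k
          unfolding \<tau>'_def wt using sumI[OF that] by (simp add: sum_divide_distrib[symmetric])
        have "(\<Sum>k\<in>I. \<tau> k l - (if k = i \<and> l = j then a else 0)) =
            (\<Sum>k\<in>I. \<tau> k l) - (if l = j then a else 0)" for l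
          using fin mem by (cases "l = j") (simp_all add: sum_subtractf)
        then show "(\<Sum>k\<in>I. \<tau>' k l) \<le> weight u' l" if "l \<in> J" for l
          unfolding \<tau>'_def wu using sumJ[OF that] a' by (simp add: sum_divide_distrib[symmetric] divide_right_mono)
      qed
      then show ?thesis unfolding evt evu keval.simps using le a t' u'
        keval_consistent[OF \<rho>, of "KVar i" t'] keval_consistent[OF \<rho>', of "KVar j" u']
        by (intro plus_mono) auto
    qed
  qed
qed

text \<open>Monotonicity in \<open>e\<close> is part of the induction because it makes the families
  of arguments directed, as continuity of the operations requires.\<close>

lemma keval_is_sup:
  assumes E: "directed_set leE E"
    and mono: "\<And>e e' n. e \<in> E \<Longrightarrow> e' \<in> E \<Longrightarrow> leE e e' \<Longrightarrow> kle K (\<rho> e n) (\<rho> e' n)"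
    and closed: "\<And>e n. e \<in> E \<Longrightarrow> \<rho> e n \<in> kcarrier K"
    and sup: "\<And>n. is_sup (kcarrier K) (kle K) ((\<lambda>e. \<rho> e n) ` E) (\<rho>' n)"
    and \<rho>': "bounded_env K \<rho>' b" and t: "wf_term t"
  shows "is_sup (kcarrier K) (kle K) ((\<lambda>e. keval K (\<rho> e) t) ` E) (keval K \<rho>' t) \<and>
    (\<forall>e\<in>E. \<forall>e'\<in>E. leE e e' \<longrightarrow> kle K (keval K (\<rho> e) t) (keval K (\<rho> e') t))"
proof -
  \<comment> \<open>Each approximating environment lies below \<open>\<rho>'\<close>, hence shares
    its bound.\<close>
  have \<rho>: "bounded_env K (\<rho> e) b" if "e \<in> E" for e
    using \<rho>' closed[OF that] sup that unfolding bounded_env_def is_sup_def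
    by (meson image_eqI kle_trans)
  show ?thesis using t
  proof (induction t)
    case (KVar n)
    then show ?case using sup mono by simp
  next
    case KZero
    have "(\<lambda>e. kzero K) ` E = {kzero K}" using directed_set_nonempty[OF E] by auto
    then show ?case using zero_closed unfolding is_sup_def by auto
  next
    case (KPlus r t u)
    let ?g = "\<lambda>e. (keval K (\<rho> e) t, keval K (\<rho> e) u)"
    have r: "r \<in> {0..1}" and wf: "wf_term t" "wf_term u" using KPlus.prems by auto
    have cons: "consistent_pair K (keval K (\<rho> e) t) (keval K (\<rho> e) u)" if "e \<in> E" for e
      using keval_consistent[OF \<rho>[OF that] wf] .
    have cons': "consistent_pair K (keval K \<rho>' t) (keval K \<rho>' u)"
      using keval_consistent[OF \<rho>' wf] .
    have "directed_set (prod_le (kle K) (kle K)) (?g ` E)"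
      using E by (rule directed_set_image) (use KPlus.IH wf in \<open>auto simp: prod_le_def\<close>)
    moreover have "is_sup (kcarrier K \<times> kcarrier K) (prod_le (kle K) (kle K)) (?g ` E)
        (keval K \<rho>' t, keval K \<rho>' u)"
      unfolding is_sup_prod_iff using KPlus.IH wf by (simp add: image_image)
    ultimately have "is_sup (kcarrier K) (kle K) ((\<lambda>p. kplus K r (fst p) (snd p)) ` ?g ` E)
        (kplus K r (keval K \<rho>' t) (keval K \<rho>' u))"
      using cons cons' by (intro plus_is_sup[OF r]) auto
    moreover have "kle K (keval K (\<rho> e) (KPlus r t u)) (keval K (\<rho> e') (KPlus r t u))"
      if "e \<in> E" "e' \<in> E" "leE e e'" for e e'
      using that cons KPlus.IH wf r plus_mono by auto
    ultimately show ?case by (simp add: image_image)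
  next
    case (KScale r t)
    let ?g = "\<lambda>e. (r, keval K (\<rho> e) t)"
    have r: "r \<in> {0..1}" and wf: "wf_term t" using KScale.prems by auto
    have dir: "directed_set (prod_le (\<le>) (kle K)) (?g ` E)"
      using E by (rule directed_set_image) (use KScale.IH wf in \<open>auto simp: prod_le_def\<close>)
    have cl: "keval K (\<rho> e) t \<in> kcarrier K" if "e \<in> E" for e
      using keval_closed[OF \<rho>[OF that] wf] .
    have "is_sup {0..1} (\<le>) ((\<lambda>e. r) ` E) r"
      using r directed_set_nonempty[OF E] unfolding is_sup_def by auto
    then have "is_sup ({0..1} \<times> kcarrier K) (prod_le (\<le>) (kle K)) (?g ` E) (r, keval K \<rho>' t)"
      unfolding is_sup_prod_iff using KScale.IH wf by (simp add: image_image)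
    moreover have "?g ` E \<subseteq> {0..1} \<times> kcarrier K" using r cl by auto
    ultimately have "is_sup (kcarrier K) (kle K) ((\<lambda>e. kscale K r (keval K (\<rho> e) t)) ` E)
        (kscale K r (keval K \<rho>' t))"
      using scale_is_sup[OF dir] by (simp add: image_image)
    moreover have "kle K (kscale K r (keval K (\<rho> e) t)) (kscale K r (keval K (\<rho> e') t))"
      if "e \<in> E" "e' \<in> E" "leE e e'" for e e'
    proof -
      have "reflp_on ({0..1::real} \<times> kcarrier K) (prod_le (\<le>) (kle K))"
        by (auto simp: reflp_on_def prod_le_def)
      from scott_continuous_mono[OF scale_cont this, of "(r, keval K (\<rho> e) t)" "(r, keval K (\<rho> e') t)"]
      show ?thesis using that r cl KScale.IH wf by (auto simp: prod_le_def)
    qed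
    ultimately show ?case by simp
  qed
qed

lemma scale_one: "x \<in> kcarrier K \<Longrightarrow> kscale K 1 x = x"
  using keval_term_eq[of "\<lambda>_. x" x "KScale 1 (KVar 0)" "KVar 0"]
    term_eq_law[OF one_scale, of "KVar 0"]
  by (simp add: bounded_env_def)

lemma scale_is_sup_right:
  assumes r: "r \<in> {0..1}" and D: "D \<subseteq> kcarrier K" "directed_set (kle K) D"
    and x: "is_sup (kcarrier K) (kle K) D x"
  shows "is_sup (kcarrier K) (kle K) (kscale K r ` D) (kscale K r x)"
proof -
  have "directed_set (\<le>) {r}" by (simp add: directed_set_def)
  from directed_set_prod[OF this D(2)]
  have "directed_set (prod_le (\<le>) (kle K)) ({r} \<times> D)" .
  moreover have "is_sup {0..1} (\<le>) {r} r" using r by (simp add: is_sup_def)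
  then have "is_sup ({0..1} \<times> kcarrier K) (prod_le (\<le>) (kle K)) ({r} \<times> D) (r, x)"
    using x directed_set_nonempty[OF D(2)] by (simp add: is_sup_prod_iff)
  ultimately have "is_sup (kcarrier K) (kle K) ((\<lambda>p. kscale K (fst p) (snd p)) ` ({r} \<times> D)) (kscale K r x)"
    using r D(1) by (intro scale_is_sup) auto
  moreover have "(\<lambda>p. kscale K (fst p) (snd p)) ` ({r} \<times> D) = kscale K r ` D" by force
  ultimately show ?thesis by simp
qed

lemma plus_is_sup_prod:
  assumes r: "r \<in> {0..1}"
    and D: "directed_set (kle K) D" "is_sup (kcarrier K) (kle K) D x"
    and E: "directed_set (kle K) E" "is_sup (kcarrier K) (kle K) E y"
    and DE: "D \<subseteq> kcarrier K" "E \<subseteq> kcarrier K" and c: "consistent_pair K x y"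
  shows "is_sup (kcarrier K) (kle K) ((\<lambda>p. kplus K r (fst p) (snd p)) ` (D \<times> E)) (kplus K r x y)"
proof (rule plus_is_sup[OF r])
  show "directed_set (prod_le (kle K) (kle K)) (D \<times> E)" using D(1) E(1) by (rule directed_set_prod)
  have "fst ` (D \<times> E) = D" "snd ` (D \<times> E) = E"
    using directed_set_nonempty[OF D(1)] directed_set_nonempty[OF E(1)] by auto
  then show "is_sup (kcarrier K \<times> kcarrier K) (prod_le (kle K) (kle K)) (D \<times> E) (x, y)"
    using D(2) E(2) by (simp add: is_sup_prod_iff)
  obtain z where z: "z \<in> kcarrier K" "kle K x z" "kle K y z" "x \<in> kcarrier K" "y \<in> kcarrier K"
    using c unfolding consistent_pair_def by blast
  show "consistent_pair K (fst p) (snd p)" if "p \<in> D \<times> E" for p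
  proof -
    have p: "fst p \<in> kcarrier K" "snd p \<in> kcarrier K" "kle K (fst p) x" "kle K (snd p) y"
      using that DE D(2) E(2) unfolding is_sup_def by auto
    then show ?thesis
      using consistent_pairI[OF p(1,2) z(1)] kle_trans[OF p(3) z(2) p(1) z(4,1)]
        kle_trans[OF p(4) z(3) p(2) z(5,1)] by blast
  qed
qed (fact c)

end

section \<open>The Scott topology of a domain\<close>

lemma way_below_imp_le:
  fixes x y :: "'a::order"
  assumes "way_below x y" shows "x \<le> y"
proof -
  have "directed_set (\<le>) {y}" "is_sup UNIV (\<le>) {y} y"
    by (auto simp: directed_set_def is_sup_def)
  with assms show ?thesis unfolding way_below_def by fastforce
qed

lemma way_below_trans_le:
  fixes x y :: "'a::order"
  shows "x \<le> y \<Longrightarrow> way_below y z \<Longrightarrow> way_below x z"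
  unfolding way_below_def by (meson order_trans)

lemma way_below_le_trans:
  fixes x y :: "'a::order"
  shows "way_below x y \<Longrightarrow> y \<le> z \<Longrightarrow> way_below x z"
  unfolding way_below_def by (meson order_trans)

text \<open>The elements two way-below steps under \<open>z\<close> form a directed set with
  supremum \<open>z\<close>, so \<open>x\<close> lies below one of them.\<close>

lemma way_below_interpolate:
  fixes x z :: "'a::continuous_dcpo"
  assumes "way_below x z"
  shows "\<exists>y. way_below x y \<and> way_below y z"
proof -
  let ?D = "{w. \<exists>y. way_below w y \<and> way_below y z}"
  have dir: "directed_set (\<le>) ?D"
  proof (rule directed_setI)
    obtain y where "way_below y z" using directed_set_nonempty[OF directed_way_below[of z]] by blast
    moreover obtain w where "way_below w y"
      using directed_set_nonempty[OF directed_way_below[of y]] by blast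
    ultimately show "?D \<noteq> {}" by blast
  next
    fix w w' assume "w \<in> ?D" "w' \<in> ?D"
    then obtain y y' where y: "way_below w y" "way_below y z" "way_below w' y'" "way_below y' z"
      by blast
    obtain y'' where y'': "way_below y'' z" "y \<le> y''" "y' \<le> y''"
      using directed_setD[OF directed_way_below[of z], of y y'] y by blast
    then have "way_below w y''" "way_below w' y''" using y way_below_le_trans by blast+
    then obtain v where "way_below v y''" "w \<le> v" "w' \<le> v"
      using directed_setD[OF directed_way_below[of y''], of w w'] by blast
    then show "\<exists>v\<in>?D. w \<le> v \<and> w' \<le> v" using y'' by blast
  qed
  have "is_sup UNIV (\<le>) ?D z"
    unfolding is_sup_def
  proof (intro conjI ballI impI)
    show "w \<le> z" if "w \<in> ?D" for w
      using that by (auto intro: order_trans[OF way_below_imp_le way_below_imp_le])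
    fix u assume u: "\<forall>w\<in>?D. w \<le> u"
    have "y \<le> u" if "way_below y z" for y
      using sup_way_below[of y] u that unfolding is_sup_def by blast
    then show "z \<le> u" using sup_way_below[of z] unfolding is_sup_def by blast
  qed simp
  with assms dir obtain w where "w \<in> ?D" "x \<le> w" unfolding way_below_def by blast
  then show ?thesis using way_below_trans_le by blast
qed

section \<open>Scott open sets\<close>

lemma scott_openI:
  assumes "\<And>x y. x \<in> U \<Longrightarrow> x \<le> y \<Longrightarrow> y \<in> U"
    and "\<And>D s. directed_set (\<le>) D \<Longrightarrow> is_sup UNIV (\<le>) D s \<Longrightarrow> s \<in> U \<Longrightarrow> \<exists>d\<in>D. d \<in> U"
  shows "scott_open U"
  using assms unfolding scott_open_def by blast

lemma scott_open_upward: "scott_open U \<Longrightarrow> x \<in> U \<Longrightarrow> x \<le> y \<Longrightarrow> y \<in> U"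
  unfolding scott_open_def by blast

lemma scott_open_directed:
  "scott_open U \<Longrightarrow> directed_set (\<le>) D \<Longrightarrow> is_sup UNIV (\<le>) D s \<Longrightarrow> s \<in> U \<Longrightarrow> \<exists>d\<in>D. d \<in> U"
  unfolding scott_open_def by blast

lemma scott_open_UNIV [simp]: "scott_open UNIV"
  unfolding scott_open_def directed_set_def by blast

lemma scott_open_Union: "(\<And>U. U \<in> \<U> \<Longrightarrow> scott_open U) \<Longrightarrow> scott_open (\<Union>\<U>)"
  unfolding scott_open_def by (metis Union_iff)

lemma scott_open_Un: "scott_open U \<Longrightarrow> scott_open V \<Longrightarrow> scott_open (U \<union> V)"
  using scott_open_Union[of "{U, V}"] by auto

lemma scott_open_Int:
  assumes "scott_open U" "scott_open V"
  shows "scott_open (U \<inter> V)"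
proof (rule scott_openI)
  fix D s assume D: "directed_set (\<le>) D" "is_sup UNIV (\<le>) D s" and s: "s \<in> U \<inter> V"
  obtain d d' where "d \<in> D" "d \<in> U" "d' \<in> D" "d' \<in> V"
    using scott_open_directed[OF assms(1) D] scott_open_directed[OF assms(2) D] s by blast
  moreover then obtain e where "e \<in> D" "d \<le> e" "d' \<le> e" using directed_setD[OF D(1)] by blast
  ultimately show "\<exists>d\<in>D. d \<in> U \<inter> V" using assms scott_open_upward by blast
qed (use assms scott_open_upward in blast)

lemma scott_open_INT:
  "finite F \<Longrightarrow> (\<And>x. x \<in> F \<Longrightarrow> scott_open (U x)) \<Longrightarrow> scott_open (\<Inter>x\<in>F. U x)"
  by (induction F rule: finite_induct) (auto intro: scott_open_Int)

lemma scott_open_not_le: "scott_open {z. \<not> z \<le> x}"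
  by (rule scott_openI) (auto simp: is_sup_def intro: order_trans)

lemma scott_open_way_above: "scott_open {z :: 'a::continuous_dcpo. way_below x z}"
proof (rule scott_openI)
  fix D s assume D: "directed_set (\<le>) D" "is_sup UNIV (\<le>) D s" and "s \<in> {z. way_below x z}"
  then obtain y where "way_below x y" "way_below y s" using way_below_interpolate by blast
  moreover then obtain d where "d \<in> D" "y \<le> d" using D unfolding way_below_def by blast
  ultimately show "\<exists>d\<in>D. d \<in> {z. way_below x z}" using way_below_le_trans by blast
qed (auto intro: way_below_le_trans)

lemma scott_open_way_below:
  fixes x :: "'a::continuous_dcpo"
  assumes "scott_open U" "x \<in> U"
  shows "\<exists>y\<in>U. way_below y x"
  using scott_open_directed[OF assms(1) directed_way_below sup_way_below assms(2)] by blast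

section \<open>Continuous valuations\<close>

lemma continuous_valuation_iff:
  "continuous_valuation \<mu> \<longleftrightarrow> valuation \<mu> \<and>
     (\<forall>\<U>. (\<forall>U\<in>\<U>. scott_open U) \<longrightarrow> directed_set (\<subseteq>) \<U> \<longrightarrow> \<mu> (\<Union>\<U>) = (SUP U\<in>\<U>. \<mu> U))"
proof -
  have sub: "\<U> \<subseteq> Collect scott_open \<longleftrightarrow> (\<forall>U\<in>\<U>. scott_open U)" for \<U> :: "'a set set"
    by auto
  have 1: "is_sup (Collect scott_open) (\<subseteq>) \<U> s \<longleftrightarrow> s = \<Union>\<U>"
    if "\<forall>U\<in>\<U>. scott_open U" for \<U> and s :: "'a set"
    using that scott_open_Union[of \<U>] by (intro is_sup_Sup_iff) auto
  have 2: "is_sup UNIV (\<le>) X s \<longleftrightarrow> s = Sup X" for X and s :: ennreal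
    by (intro is_sup_Sup_iff) auto
  show ?thesis
    unfolding continuous_valuation_def scott_continuous_def by (simp add: sub 1 2 cong: imp_cong)
qed

section \<open>Closure properties of subprobability valuations\<close>

lemma subprob_vals_iff:
  "\<mu> \<in> subprob_vals \<longleftrightarrow>
     (\<forall>U. \<not> scott_open U \<longrightarrow> \<mu> U = 0) \<and> \<mu> {} = 0 \<and>
     (\<forall>U V. scott_open U \<longrightarrow> scott_open V \<longrightarrow> U \<subseteq> V \<longrightarrow> \<mu> U \<le> \<mu> V) \<and>
     (\<forall>U V. scott_open U \<longrightarrow> scott_open V \<longrightarrow> \<mu> U + \<mu> V = \<mu> (U \<union> V) + \<mu> (U \<inter> V)) \<and>
     (\<forall>\<U>. (\<forall>U\<in>\<U>. scott_open U) \<longrightarrow> directed_set (\<subseteq>) \<U> \<longrightarrow> \<mu> (\<Union>\<U>) = (SUP U\<in>\<U>. \<mu> U)) \<and>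
     (\<forall>U. scott_open U \<longrightarrow> \<mu> U \<le> 1)"
  unfolding subprob_vals_def continuous_valuation_iff valuation_def by auto

lemma subprob_vals_zero: "(\<lambda>U. 0) \<in> subprob_vals"
proof -
  have "(SUP U\<in>\<U>. 0::ennreal) = 0" if "directed_set (\<subseteq>) \<U>" for \<U> :: "'a set set"
    using directed_set_nonempty[OF that] by simp
  then show ?thesis unfolding subprob_vals_iff by auto
qed

lemma subprob_vals_mono: "\<mu> \<in> subprob_vals \<Longrightarrow> scott_open U \<Longrightarrow> scott_open V \<Longrightarrow> U \<subseteq> V \<Longrightarrow> \<mu> U \<le> \<mu> V"
  unfolding subprob_vals_iff by blast

lemma subprob_vals_not_open: "\<mu> \<in> subprob_vals \<Longrightarrow> \<not> scott_open U \<Longrightarrow> \<mu> U = 0"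
  unfolding subprob_vals_iff by blast

lemma subprob_vals_empty: "\<mu> \<in> subprob_vals \<Longrightarrow> \<mu> {} = 0"
  unfolding subprob_vals_iff by (elim conjE)

lemma subprob_vals_modular:
  "\<mu> \<in> subprob_vals \<Longrightarrow> scott_open U \<Longrightarrow> scott_open V \<Longrightarrow>
     \<mu> U + \<mu> V = \<mu> (U \<union> V) + \<mu> (U \<inter> V)"
  unfolding subprob_vals_iff by (elim conjE) simp

lemma subprob_vals_Union:
  "\<mu> \<in> subprob_vals \<Longrightarrow> (\<And>U. U \<in> \<U> \<Longrightarrow> scott_open U) \<Longrightarrow> directed_set (\<subseteq>) \<U> \<Longrightarrow>
     \<mu> (\<Union>\<U>) = (SUP U\<in>\<U>. \<mu> U)"
  unfolding subprob_vals_iff by (elim conjE) simp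

lemma subprob_vals_le_1: "\<mu> \<in> subprob_vals \<Longrightarrow> \<mu> U \<le> 1"
  unfolding subprob_vals_iff by (cases "scott_open U") auto

lemma subprob_vals_dirac: "dirac x \<in> subprob_vals"
  unfolding subprob_vals_iff
proof (intro conjI allI impI)
  fix \<U> :: "'a set set" assume op: "\<forall>U\<in>\<U>. scott_open U" and dir: "directed_set (\<subseteq>) \<U>"
  have "dirac x (\<Union>\<U>) \<le> (SUP U\<in>\<U>. dirac x U)"
  proof (cases "x \<in> \<Union>\<U>")
    case True
    then obtain U where U: "U \<in> \<U>" "x \<in> U" by blast
    then have "dirac x (\<Union>\<U>) \<le> dirac x U" using op unfolding dirac_def by simp
    with U(1) show ?thesis by (rule SUP_upper2)
  qed (simp add: dirac_def)
  moreover have "(SUP U\<in>\<U>. dirac x U) \<le> dirac x (\<Union>\<U>)"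
    using op scott_open_Union[of \<U>] by (intro SUP_least) (auto simp: dirac_def)
  ultimately show "dirac x (\<Union>\<U>) = (SUP U\<in>\<U>. dirac x U)" by (rule antisym)
qed (auto simp: dirac_def scott_open_Un scott_open_Int)

lemma convex_combination_le_1:
  assumes "r \<in> {0..1}" "a \<le> 1" "b \<le> 1"
  shows "ennreal r * a + ennreal (1 - r) * b \<le> 1"
proof -
  have "ennreal r * a + ennreal (1 - r) * b \<le> ennreal r * 1 + ennreal (1 - r) * 1"
    using assms by (intro add_mono mult_left_mono) auto
  also have "\<dots> = 1" using assms by (simp flip: ennreal_plus)
  finally show ?thesis .
qed

lemma subprob_vals_plus:
  assumes r: "r \<in> {0..1}" and "\<mu> \<in> subprob_vals" "\<nu> \<in> subprob_vals"
  shows "(\<lambda>U. ennreal r * \<mu> U + ennreal (1 - r) * \<nu> U) \<in> subprob_vals"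
proof -
  let ?c = "\<lambda>U. ennreal r * \<mu> U + ennreal (1 - r) * \<nu> U"
  note \<mu> = assms(2)[unfolded subprob_vals_iff] and \<nu> = assms(3)[unfolded subprob_vals_iff]
  have mono: "?c U \<le> ?c V" if "scott_open U" "scott_open V" "U \<subseteq> V" for U V
    using \<mu> \<nu> that by (intro add_mono mult_left_mono) auto
  have "?c U + ?c V = ?c (U \<union> V) + ?c (U \<inter> V)" if "scott_open U" "scott_open V" for U V
  proof -
    have "?c U + ?c V = ennreal r * (\<mu> U + \<mu> V) + ennreal (1 - r) * (\<nu> U + \<nu> V)"
      by (simp add: algebra_simps)
    also have "\<mu> U + \<mu> V = \<mu> (U \<union> V) + \<mu> (U \<inter> V)" using \<mu> that by blast
    also have "\<nu> U + \<nu> V = \<nu> (U \<union> V) + \<nu> (U \<inter> V)" using \<nu> that by blast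
    finally show ?thesis by (simp add: algebra_simps)
  qed
  moreover have "?c (\<Union>\<U>) = (SUP U\<in>\<U>. ?c U)"
    if op: "\<forall>U\<in>\<U>. scott_open U" and dir: "directed_set (\<subseteq>) \<U>" for \<U>
  proof -
    have "?c (\<Union>\<U>) = (SUP U\<in>\<U>. ennreal r * \<mu> U) + (SUP U\<in>\<U>. ennreal (1 - r) * \<nu> U)"
      using \<mu> \<nu> op dir by (simp add: SUP_mult_left_ennreal)
    also have "\<dots> = (SUP U\<in>\<U>. ?c U)"
    proof (rule SUP_add_directed_ennreal[symmetric])
      fix U V assume "U \<in> \<U>" "V \<in> \<U>"
      then obtain W where "W \<in> \<U>" "U \<subseteq> W" "V \<subseteq> W" using directed_setD[OF dir] by blast
      then show "\<exists>k\<in>\<U>. ennreal r * \<mu> U + ennreal (1 - r) * \<nu> V \<le> ?c k"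
        using \<mu> \<nu> op \<open>U \<in> \<U>\<close> \<open>V \<in> \<U>\<close> by (intro bexI[of _ W] add_mono mult_left_mono) auto
    qed
    finally show ?thesis .
  qed
  ultimately show ?thesis
    unfolding subprob_vals_iff using \<mu> \<nu> mono convex_combination_le_1[OF r] by simp
qed

lemma subprob_vals_scale:
  assumes "r \<in> {0..1}" "\<mu> \<in> subprob_vals"
  shows "(\<lambda>U. ennreal r * \<mu> U) \<in> subprob_vals"
  using subprob_vals_plus[OF assms subprob_vals_zero] by simp

text \<open>Modularity survives because addition on \<open>ennreal\<close> commutes with directed
  suprema; continuity is an exchange of two suprema.\<close>

lemma subprob_vals_Sup:
  assumes D: "D \<subseteq> subprob_vals" and dir: "directed_set (\<le>) D"
  shows "Sup D \<in> subprob_vals"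
  unfolding subprob_vals_iff
proof (intro conjI allI impI)
  fix U V :: "'a set" assume op: "scott_open U" "scott_open V"
  have add: "(SUP \<mu>\<in>D. \<mu> A) + (SUP \<mu>\<in>D. \<mu> B) = (SUP \<mu>\<in>D. \<mu> A + \<mu> B)" for A B
  proof (rule SUP_add_directed_ennreal[symmetric])
    fix \<mu> \<nu> assume "\<mu> \<in> D" "\<nu> \<in> D"
    then obtain \<kappa> where "\<kappa> \<in> D" "\<mu> \<le> \<kappa>" "\<nu> \<le> \<kappa>" using directed_setD[OF dir] by blast
    then show "\<exists>\<kappa>\<in>D. \<mu> A + \<nu> B \<le> \<kappa> A + \<kappa> B"
      by (intro bexI[of _ \<kappa>] add_mono) (auto dest: le_funD)
  qed
  have "\<mu> U + \<mu> V = \<mu> (U \<union> V) + \<mu> (U \<inter> V)" if "\<mu> \<in> D" for \<mu>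
    using that D op subprob_vals_modular by blast
  then show "Sup D U + Sup D V = Sup D (U \<union> V) + Sup D (U \<inter> V)"
    unfolding Sup_apply image_image add by (rule SUP_cong[OF HOL.refl])
next
  fix U V :: "'a set" assume "scott_open U" "scott_open V" "U \<subseteq> V"
  then show "Sup D U \<le> Sup D V"
    unfolding Sup_apply using D subprob_vals_mono by (intro SUP_mono) blast
next
  fix \<U> :: "'a set set" assume "\<forall>U\<in>\<U>. scott_open U" "directed_set (\<subseteq>) \<U>"
  then have "\<mu> (\<Union>\<U>) = (SUP U\<in>\<U>. \<mu> U)" if "\<mu> \<in> D" for \<mu>
    using that D subprob_vals_Union by blast
  then have "Sup D (\<Union>\<U>) = (SUP \<mu>\<in>D. SUP U\<in>\<U>. \<mu> U)"
    unfolding Sup_apply by (rule SUP_cong[OF HOL.refl])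
  also have "\<dots> = (SUP U\<in>\<U>. SUP \<mu>\<in>D. \<mu> U)" by (rule SUP_commute)
  finally show "Sup D (\<Union>\<U>) = (SUP U\<in>\<U>. Sup D U)" by simp
next
  fix U :: "'a set" assume "\<not> scott_open U"
  then have "\<mu> U = 0" if "\<mu> \<in> D" for \<mu> using that D subprob_vals_not_open by blast
  then show "Sup D U = 0" using le_zero_eq unfolding Sup_apply by (metis SUP_least order_refl)
next
  have "\<mu> {} = 0" if "\<mu> \<in> D" for \<mu> using that D subprob_vals_empty by blast
  then show "Sup D {} = 0" using le_zero_eq unfolding Sup_apply by (metis SUP_least order_refl)
next
  show "Sup D U \<le> 1" for U
    unfolding Sup_apply using D subprob_vals_le_1 by (intro SUP_least) blast
qed

section \<open>Simple valuations as terms\<close>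

text \<open>\<open>keval\<close> uses only the total functions stored in the record
  \<open>Vc\<close>, so terms can be evaluated there before \<open>Vc\<close> is known to be a
  kegelspitze. Homomorphisms on \<open>Vc\<close> can later be followed through this evaluation term
  by term.\<close>

definition term_val :: "kterm \<Rightarrow> (nat \<Rightarrow> 'a::order) \<Rightarrow> 'a set \<Rightarrow> ennreal" where
  "term_val t x = keval Vc (\<lambda>n. dirac (x n)) t"

lemma term_val_simps [simp]:
  "term_val (KVar n) x = dirac (x n)"
  "term_val KZero x = (\<lambda>U. 0)"
  "term_val (KPlus r t u) x = (\<lambda>U. ennreal r * term_val t x U + ennreal (1 - r) * term_val u x U)"
  "term_val (KScale r t) x = (\<lambda>U. ennreal r * term_val t x U)"
  by (simp_all add: term_val_def Vc_def)

lemma term_val_rename [simp]: "term_val (rename g t) x = term_val t (\<lambda>n. x (g n))"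
  by (simp add: term_val_def)

lemma dirac_mono: "x \<le> y \<Longrightarrow> dirac x \<le> dirac y"
  unfolding dirac_def le_fun_def by (auto intro: scott_open_upward)

lemma term_val_mono: "(\<And>n. x n \<le> y n) \<Longrightarrow> term_val t x \<le> term_val t y"
proof (induction t)
  case (KVar n)
  then show ?case by (simp add: dirac_mono)
next
  case (KPlus r t u)
  then show ?case by (auto simp: le_fun_def intro!: add_mono mult_left_mono)
next
  case (KScale r t)
  then show ?case by (auto simp: le_fun_def intro!: mult_left_mono)
qed simp

lemma term_val_subprob: "wf_term t \<Longrightarrow> term_val t x \<in> subprob_vals"
  by (induction t) (auto simp: subprob_vals_dirac subprob_vals_zero
      intro: subprob_vals_plus subprob_vals_scale)

lemma convex_combination_le:
  fixes a b c :: ennreal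
  assumes "r \<in> {0..1}" "a \<le> c" "b \<le> c"
  shows "ennreal r * a + ennreal (1 - r) * b \<le> c"
proof -
  have "ennreal r * a + ennreal (1 - r) * b \<le> ennreal r * c + ennreal (1 - r) * c"
    using assms by (intro add_mono mult_left_mono) auto
  also have "\<dots> = c" using assms by (simp flip: ennreal_plus distrib_right)
  finally show ?thesis .
qed

lemma scale_le_self:
  fixes a :: ennreal
  assumes "r \<in> {0..1}"
  shows "ennreal r * a \<le> a"
  using convex_combination_le[OF assms, of a a 0] by simp

lemma term_val_le_dirac:
  assumes "wf_term t" "\<And>n. x n \<le> y"
  shows "term_val t x \<le> dirac y"
  using assms(1)
proof (induction t)
  case (KVar n)
  then show ?case using assms(2) by (simp add: dirac_mono)
next
  case (KPlus r t u)
  then show ?case by (auto simp: le_fun_def intro!: convex_combination_le)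
next
  case (KScale r t)
  then show ?case by (auto simp: le_fun_def intro: order_trans[OF scale_le_self])
qed (simp add: le_fun_def)

lemma term_val_eq_sum:
  assumes "finite I" "wf_term t" "term_vars t \<subseteq> I"
  shows "term_val t x U = (\<Sum>i\<in>I. ennreal (weight t i) * dirac (x i) U)"
  using assms(2,3)
proof (induction t)
  case (KVar n)
  then have "(\<Sum>i\<in>I. ennreal (weight (KVar n) i) * dirac (x i) U) =
      (\<Sum>i\<in>I. if i = n then dirac (x n) U else 0)"
    by (intro sum.cong) auto
  then show ?case using KVar assms(1) by simp
next
  case (KPlus r t u)
  have "(\<Sum>i\<in>I. ennreal (weight (KPlus r t u) i) * dirac (x i) U) =
    (\<Sum>i\<in>I. ennreal r * (ennreal (weight t i) * dirac (x i) U) +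
       ennreal (1 - r) * (ennreal (weight u i) * dirac (x i) U))"
    using KPlus.prems by (intro sum.cong HOL.refl)
      (simp add: ennreal_plus ennreal_mult weight_nonneg distrib_right mult.assoc)
  then show ?case using KPlus by (simp add: sum.distrib sum_distrib_left)
next
  case (KScale r t)
  have "(\<Sum>i\<in>I. ennreal (weight (KScale r t) i) * dirac (x i) U) =
    (\<Sum>i\<in>I. ennreal r * (ennreal (weight t i) * dirac (x i) U))"
    using KScale.prems by (intro sum.cong HOL.refl)
      (simp add: ennreal_mult weight_nonneg mult.assoc)
  then show ?case using KScale by (simp add: sum_distrib_left)
qed simp

lemma term_val_open_eq:
  assumes "finite I" "wf_term t" "term_vars t \<subseteq> I" "scott_open U"
  shows "term_val t x U = ennreal (\<Sum>i\<in>{i\<in>I. x i \<in> U}. weight t i)"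
proof -
  have "term_val t x U = (\<Sum>i\<in>I. if x i \<in> U then ennreal (weight t i) else 0)"
    unfolding term_val_eq_sum[OF assms(1-3)] using assms(4)
    by (intro sum.cong HOL.refl) (simp add: dirac_def)
  also have "\<dots> = (\<Sum>i\<in>{i\<in>I. x i \<in> U}. ennreal (weight t i))"
    using assms(1) by (simp add: sum.inter_filter)
  finally show ?thesis using assms(2) by (simp add: sum_ennreal weight_nonneg)
qed

text \<open>Simple valuations below a Dirac valuation are represented by terms with an environment of points
  that has an upper bound, so that the term can also be evaluated in any other kegelspitze.\<close>

definition gens :: "(kterm \<times> (nat \<Rightarrow> 'a::order)) set" where
  "gens = {p. wf_term (fst p) \<and> bdd_above (range (snd p))}"

abbreviation gen_val :: "kterm \<times> (nat \<Rightarrow> 'a::order) \<Rightarrow> 'a set \<Rightarrow> ennreal" where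
  "gen_val p \<equiv> term_val (fst p) (snd p)"

lemma gen_val_subprob: "p \<in> gens \<Longrightarrow> gen_val p \<in> subprob_vals"
  unfolding gens_def by (simp add: term_val_subprob)

lemma gen_vals_subprob: "gen_val ` gens \<subseteq> subprob_vals"
  using gen_val_subprob by (rule image_subsetI)

lemma gen_val_le_dirac: "p \<in> gens \<Longrightarrow> \<exists>y. gen_val p \<le> dirac y"
proof -
  assume p: "p \<in> gens"
  then obtain y where "\<And>n. snd p n \<le> y" unfolding gens_def bdd_above_def by auto
  then have "gen_val p \<le> dirac y" using p unfolding gens_def by (intro term_val_le_dirac) auto
  then show ?thesis ..
qed

text \<open>A point of positive weight outside the principal ideal of \<open>y\<close> would put
  mass on the open complement of that ideal, where \<open>dirac y\<close> vanishes. Points of weight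
  0 may lie anywhere; \<open>x'\<close> moves them to \<open>y\<close>, together with the surplus
  indices.\<close>

lemma simple_valuation_below_dirac:
  assumes \<nu>: "\<nu> \<in> subprob_vals" "simple_valuation \<nu>" "\<nu> \<le> dirac y"
  shows "\<exists>t x. wf_term t \<and> (\<forall>n. x n \<le> y) \<and> \<nu> = term_val t x"
proof -
  obtain n :: nat and r x where r: "\<And>i. i < n \<Longrightarrow> 0 \<le> r i"
    and \<nu>_eq: "\<nu> = (\<lambda>U. \<Sum>i<n. ennreal (r i) * dirac (x i) U)"
    using \<nu>(2) unfolding simple_valuation_def by blast
  have "ennreal (\<Sum>i<n. r i) = \<nu> UNIV"
    unfolding \<nu>_eq using r sum_ennreal[of "{..<n}" r] by (simp add: dirac_def)
  also have "\<dots> \<le> 1" using subprob_vals_le_1[OF \<nu>(1)] .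
  finally have "(\<Sum>i<n. r i) \<le> 1" by simp
  then obtain t where t: "wf_term t" "term_vars t \<subseteq> {..<n}" "\<And>i. i < n \<Longrightarrow> weight t i = r i"
    using term_of_weights[of n r] r by blast
  define x' where "x' = (\<lambda>i. if i < n \<and> r i > 0 then x i else y)"
  have "x i \<le> y" if i: "i < n" "r i > 0" for i
  proof (rule ccontr)
    assume "\<not> x i \<le> y"
    then have "ennreal (r i) = ennreal (r i) * dirac (x i) {z. \<not> z \<le> y}"
      by (simp add: dirac_def scott_open_not_le)
    also have "\<dots> \<le> (\<Sum>i<n. ennreal (r i) * dirac (x i) {z. \<not> z \<le> y})"
      using i by (intro member_le_sum) auto
    also have "\<dots> = \<nu> {z. \<not> z \<le> y}" unfolding \<nu>_eq ..
    also have "\<dots> \<le> dirac y {z. \<not> z \<le> y}" using \<nu>(3) by (rule le_funD)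
    also have "\<dots> = 0" by (simp add: dirac_def)
    finally show False using i by (simp add: ennreal_eq_0_iff)
  qed
  then have "\<forall>n. x' n \<le> y" unfolding x'_def by auto
  moreover have "\<nu> = term_val t x'"
  proof
    show "\<nu> U = term_val t x' U" for U
      unfolding term_val_eq_sum[OF finite_lessThan t(1,2)] \<nu>_eq
      using t(3) r by (intro sum.cong HOL.refl) (force simp: x'_def)
  qed
  ultimately show ?thesis using t(1) by blast
qed

lemma simple_valuation_term_val:
  assumes "wf_term t"
  shows "simple_valuation (term_val t x)"
proof -
  obtain n where n: "term_vars t \<subseteq> {..<n}" using finite_nat_iff_bounded finite_term_vars by blast
  show ?thesis unfolding simple_valuation_def
    using term_val_eq_sum[OF finite_lessThan assms n] weight_nonneg[OF assms] by blast
qed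

lemma simple_below_dirac_eq:
  "{\<nu> \<in> subprob_vals. simple_valuation \<nu> \<and> (\<exists>y. \<nu> \<le> dirac y)} = gen_val ` gens"
proof -
  have "simple_valuation (gen_val p)" if "p \<in> gens" for p :: "kterm \<times> (nat \<Rightarrow> 'a)"
    using that simple_valuation_term_val unfolding gens_def by blast
  moreover have "\<exists>p\<in>gens. \<nu> = gen_val p"
    if \<nu>: "\<nu> \<in> subprob_vals" "simple_valuation \<nu>" "\<nu> \<le> dirac y" for \<nu> and y :: 'a
  proof -
    obtain t x where "wf_term t" "\<forall>n. x n \<le> y" "\<nu> = term_val t x"
      using simple_valuation_below_dirac[OF \<nu>] by blast
    then show ?thesis by (intro bexI[of _ "(t, x)"]) (auto simp: gens_def bdd_above_def)
  qed
  ultimately show ?thesis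
    using gen_val_subprob gen_val_le_dirac
    by (intro equalityI subsetI) blast+
qed

text \<open>New representations with all points below \<open>y\<close> are chosen, because the
  environments of \<open>p\<close> and \<open>q\<close> may have points of weight 0 elsewhere. They
  are interleaved on even and odd variables, so that \<open>KPlus r t u\<close> over
  \<open>x\<close> is again a generator.\<close>

lemma gens_common_env:
  assumes p: "p \<in> gens" "gen_val p \<le> dirac y" and q: "q \<in> gens" "gen_val q \<le> dirac y"
  obtains t u x where "wf_term t" "wf_term u" "\<And>n. x n \<le> y" "gen_val p = term_val t x" "gen_val q = term_val u x"
proof -
  have "simple_valuation (gen_val p)" "simple_valuation (gen_val q)"
    using p q simple_valuation_term_val unfolding gens_def by auto
  then obtain t x u x' where t: "wf_term t" "\<And>n. x n \<le> y" "gen_val p = term_val t x"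
    and u: "wf_term u" "\<And>n. x' n \<le> y" "gen_val q = term_val u x'"
    using simple_valuation_below_dirac[OF gen_val_subprob[OF p(1)] _ p(2)]
      simple_valuation_below_dirac[OF gen_val_subprob[OF q(1)] _ q(2)] by metis
  show thesis
  proof (rule that)
    let ?z = "\<lambda>n. if even n then x (n div 2) else x' (n div 2)"
    show "gen_val p = term_val (rename (\<lambda>n. 2 * n) t) ?z" using t(3) by simp
    show "gen_val q = term_val (rename (\<lambda>n. 2 * n + 1) u) ?z" using u(3) by simp
    show "?z n \<le> y" for n using t(2) u(2) by simp
  qed (use t u in auto)
qed

lemma consistent_vals_eq:
  "consistent_vals = {Sup D | D. D \<subseteq> gen_val ` gens \<and> directed_set (\<le>) D}"
proof -
  have "is_sup subprob_vals (\<le>) D \<mu> \<longleftrightarrow> \<mu> = Sup D"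
    if "D \<subseteq> gen_val ` gens" "directed_set (\<le>) D" for D and \<mu> :: "'a set \<Rightarrow> ennreal"
    using that gen_vals_subprob by (intro is_sup_Sup_iff subprob_vals_Sup) (blast, assumption)
  then show ?thesis unfolding consistent_vals_def simple_below_dirac_eq by blast
qed

lemma consistent_vals_subprob: "\<mu> \<in> consistent_vals \<Longrightarrow> \<mu> \<in> subprob_vals"
  unfolding consistent_vals_def is_sup_def by blast

lemma gen_val_consistent: "p \<in> gens \<Longrightarrow> gen_val p \<in> consistent_vals"
proof -
  assume "p \<in> gens"
  then have "{gen_val p} \<subseteq> gen_val ` gens" by blast
  moreover have "directed_set (\<le>) {gen_val p}" by (simp add: directed_set_def)
  moreover have "gen_val p = Sup {gen_val p}" by simp
  ultimately show ?thesis unfolding consistent_vals_eq by blast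
qed

lemma dirac_consistent: "dirac x \<in> consistent_vals"
  using gen_val_consistent[of "(KVar 0, \<lambda>_. x)"] by (auto simp: gens_def bdd_above_def)

section \<open>Approximation from below\<close>

text \<open>The way-below relation of \<open>subprob_vals\<close>, where directed suprema are
  pointwise. Consistent valuations do not enter, so the relation can be used to show that these are
  closed under directed suprema.\<close>

definition val_way_below :: "('a::order set \<Rightarrow> ennreal) \<Rightarrow> ('a set \<Rightarrow> ennreal) \<Rightarrow> bool" where
  "val_way_below \<nu> \<mu> \<longleftrightarrow>
     (\<forall>M\<subseteq>subprob_vals. directed_set (\<le>) M \<longrightarrow> \<mu> \<le> Sup M \<longrightarrow> (\<exists>m\<in>M. \<nu> \<le> m))"

lemma val_way_belowD:
  "val_way_below \<nu> \<mu> \<Longrightarrow> M \<subseteq> subprob_vals \<Longrightarrow> directed_set (\<le>) M \<Longrightarrow> \<mu> \<le> Sup M \<Longrightarrow> \<exists>m\<in>M. \<nu> \<le> m"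
  unfolding val_way_below_def by blast

lemma val_way_below_le_trans: "val_way_below \<nu> \<mu> \<Longrightarrow> \<mu> \<le> \<mu>' \<Longrightarrow> val_way_below \<nu> \<mu>'"
  unfolding val_way_below_def by (meson order_trans)

text \<open>The factor has to stay below 1: \<open>dirac x\<close> is the supremum of its multiples
  by factors \<open>s < 1\<close>, and by total mass none of these lies above any
  \<open>dirac y\<close>.\<close>

definition approximants :: "(nat \<Rightarrow> 'a::order) \<Rightarrow> (real \<times> (nat \<Rightarrow> 'a)) set" where
  "approximants x = {e. fst e \<in> {0..<1} \<and> (\<forall>n. way_below (snd e n) (x n))}"

lemma approximants_directed:
  fixes x :: "nat \<Rightarrow> 'a::continuous_dcpo"
  shows "directed_set (prod_le (\<le>) (\<le>)) (approximants x)"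
proof (rule directed_setI)
  have "\<forall>n. \<exists>y. way_below y (x n)"
    using directed_set_nonempty[OF directed_way_below] by blast
  then obtain y where "\<forall>n. way_below (y n) (x n)" by metis
  then have "(0, y) \<in> approximants x" by (simp add: approximants_def)
  then show "approximants x \<noteq> {}" by blast
next
  fix e e' assume e: "e \<in> approximants x" "e' \<in> approximants x"
  have "\<forall>n. \<exists>z. way_below z (x n) \<and> snd e n \<le> z \<and> snd e' n \<le> z"
  proof
    fix n
    have "snd e n \<in> {y. way_below y (x n)}" "snd e' n \<in> {y. way_below y (x n)}"
      using e by (auto simp: approximants_def)
    from directed_setD[OF directed_way_below this]
    show "\<exists>z. way_below z (x n) \<and> snd e n \<le> z \<and> snd e' n \<le> z" by blast
  qed
  then obtain z where z: "\<forall>n. way_below (z n) (x n) \<and> snd e n \<le> z n \<and> snd e' n \<le> z n" by metis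
  show "\<exists>d\<in>approximants x. prod_le (\<le>) (\<le>) e d \<and> prod_le (\<le>) (\<le>) e' d"
    using e z by (intro bexI[of _ "(max (fst e) (fst e'), z)"])
      (auto simp: approximants_def prod_le_def le_fun_def)
qed

lemma approximant_le: "e \<in> approximants x \<Longrightarrow> snd e n \<le> x n"
  unfolding approximants_def using way_below_imp_le by blast

lemma approximant_gen:
  assumes "(t, x) \<in> gens" "e \<in> approximants x"
  shows "(KScale (fst e) t, snd e) \<in> gens"
proof -
  have "bdd_above (range (snd e))"
    using assms approximant_le[OF assms(2)] unfolding gens_def bdd_above_def
    by simp (meson order_trans)
  then show ?thesis using assms unfolding gens_def approximants_def by auto
qed

text \<open>An open set \<open>U\<close> that contains the points \<open>x'\<^sub>i\<close> with \<open>i \<in> A\<close> also contains the open set \<open>W A\<close>, to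
  which \<open>term_val t x\<close> gives at least the total weight of \<open>A\<close>. As there are only finitely many \<open>A\<close>, one
  member of the directed set serves them all.\<close>

lemma approximant_way_below:
  fixes x :: "nat \<Rightarrow> 'a::continuous_dcpo"
  assumes t: "wf_term t" and e: "e \<in> approximants x"
  shows "val_way_below (term_val (KScale (fst e) t) (snd e)) (term_val t x)"
  unfolding val_way_below_def
proof (intro allI impI)
  fix M :: "('a set \<Rightarrow> ennreal) set"
  assume M: "M \<subseteq> subprob_vals" and dir: "directed_set (\<le>) M" and le: "term_val t x \<le> Sup M"
  define s x' where "s = fst e" and "x' = snd e"
  have s: "0 \<le> s" "s < 1" and x': "\<And>n. way_below (x' n) (x n)"
    using e unfolding approximants_def s_def x'_def by auto
  define I where "I = term_vars t"
  have I: "finite I" "term_vars t \<subseteq> I" unfolding I_def by auto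
  define W where "W = (\<lambda>A. \<Union>i\<in>A. {z. way_below (x' i) z})"
  have W: "scott_open (W A)" for A
    unfolding W_def using scott_open_way_above by (intro scott_open_Union) auto
  have ex: "\<exists>m\<in>M. ennreal (s * sum (weight t) A) \<le> m (W A)" if A: "A \<subseteq> I" for A
  proof (cases "sum (weight t) A = 0")
    case True
    then show ?thesis using directed_set_nonempty[OF dir] by auto
  next
    case False
    have pos: "0 < sum (weight t) A" using False weight_nonneg[OF t] by (simp add: sum_nonneg less_le)
    \<comment> \<open>The strictness gained from \<open>s < 1\<close> is essential: a value strictly
      below a supremum is exceeded by a single member.\<close>
    then have "s * sum (weight t) A < sum (weight t) A" using s by simp
    then have "ennreal (s * sum (weight t) A) < ennreal (sum (weight t) A)"
      using s pos by (simp add: ennreal_less_iff)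
    also have "\<dots> \<le> ennreal (\<Sum>i\<in>{i\<in>I. x i \<in> W A}. weight t i)"
      using A I(1) x' weight_nonneg[OF t] unfolding W_def
      by (intro ennreal_leI sum_mono2) auto
    also have "\<dots> = term_val t x (W A)" using term_val_open_eq[OF I(1) t I(2) W] by simp
    also have "\<dots> \<le> Sup M (W A)" using le by (rule le_funD)
    finally show ?thesis unfolding Sup_apply less_SUP_iff by (meson less_imp_le)
  qed
  define m where "m = (\<lambda>A. SOME m. m \<in> M \<and> ennreal (s * sum (weight t) A) \<le> m (W A))"
  have m: "m A \<in> M" "ennreal (s * sum (weight t) A) \<le> m A (W A)" if "A \<subseteq> I" for A
    using someI_ex[of "\<lambda>m. m \<in> M \<and> ennreal (s * sum (weight t) A) \<le> m (W A)"] ex[OF that]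
    unfolding m_def by blast+
  have "finite (m ` Pow I)" "m ` Pow I \<subseteq> M" using I m by auto
  then obtain k where k: "k \<in> M" "\<forall>l\<in>m ` Pow I. l \<le> k"
    using directed_set_finite_upper_bound[OF dir] by blast
  have "term_val (KScale s t) x' U \<le> k U" for U
  proof (cases "scott_open U")
    case False
    have "wf_term (KScale s t)" using t s by simp
    from subprob_vals_not_open[OF term_val_subprob[OF this] False] show ?thesis by (simp only: zero_le)
  next
    case True
    let ?A = "{i\<in>I. x' i \<in> U}"
    have "W ?A \<subseteq> U" unfolding W_def using scott_open_upward[OF True] way_below_imp_le by blast
    have "term_val (KScale s t) x' U = ennreal (s * sum (weight t) ?A)"
      using term_val_open_eq[OF I(1) t I(2) True, of x'] s
      by (simp add: ennreal_mult sum_nonneg weight_nonneg[OF t])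
    also have "\<dots> \<le> m ?A (W ?A)" by (intro m) auto
    also have "\<dots> \<le> k (W ?A)" using k(2) by (auto intro: le_funD)
    also have "\<dots> \<le> k U" using k(1) M W True \<open>W ?A \<subseteq> U\<close> by (intro subprob_vals_mono) auto
    finally show ?thesis .
  qed
  then show "\<exists>m\<in>M. term_val (KScale (fst e) t) (snd e) \<le> m"
    using k(1) unfolding s_def x'_def le_fun_def by blast
qed

text \<open>For a fixed open \<open>U\<close>, the points inside \<open>U\<close> can be replaced by
  points way below them that are still in \<open>U\<close>, which loses no mass on \<open>U\<close>.
  The factor is then removed by letting it tend to 1.\<close>

lemma approximants_Sup:
  fixes x :: "nat \<Rightarrow> 'a::continuous_dcpo"
  assumes t: "wf_term t"
  shows "(SUP e\<in>approximants x. term_val (KScale (fst e) t) (snd e)) = term_val t x"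
proof (rule antisym)
  show "(SUP e\<in>approximants x. term_val (KScale (fst e) t) (snd e)) \<le> term_val t x"
  proof (rule SUP_least)
    fix e assume e: "e \<in> approximants x"
    then have "term_val (KScale (fst e) t) (snd e) \<le> term_val t (snd e)"
      by (auto simp: le_fun_def approximants_def intro!: scale_le_self)
    also have "\<dots> \<le> term_val t x" using approximant_le[OF e] by (rule term_val_mono)
    finally show "term_val (KScale (fst e) t) (snd e) \<le> term_val t x" .
  qed
  show "term_val t x \<le> (SUP e\<in>approximants x. term_val (KScale (fst e) t) (snd e))"
  proof (rule le_funI)
    fix U
    let ?S = "(SUP e\<in>approximants x. term_val (KScale (fst e) t) (snd e)) U"
    show "term_val t x U \<le> ?S"
    proof (cases "scott_open U")
      case False
      show ?thesis using subprob_vals_not_open[OF term_val_subprob[OF t] False, of x]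
        by (simp only: zero_le)
    next
      case True
      have "\<forall>n. \<exists>y. way_below y (x n) \<and> (x n \<in> U \<longrightarrow> y \<in> U)"
        using scott_open_way_below[OF True] directed_set_nonempty[OF directed_way_below] by blast
      then obtain y where y: "\<And>n. way_below (y n) (x n)" "\<And>n. x n \<in> U \<Longrightarrow> y n \<in> U" by metis
      have le: "term_val t x U \<le> term_val t y U"
        unfolding term_val_open_eq[OF finite_term_vars t subset_refl True]
        using y(2) weight_nonneg[OF t] by (intro ennreal_leI sum_mono2) auto
      show ?thesis
      proof (rule ennreal_approx_unit)
        fix a :: ennreal assume a: "0 < a" "a < 1"
        then obtain s where s: "a = ennreal s" "0 \<le> s" "s < 1"
          by (cases a) auto
        then have "(s, y) \<in> approximants x" using y(1) by (simp add: approximants_def)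
        then have "term_val (KScale s t) y U \<le> ?S"
          unfolding Sup_apply image_image by (rule SUP_upper2) simp
        moreover have "a * term_val t x U \<le> a * term_val t y U" using le by (rule mult_left_mono) simp
        ultimately show "a * term_val t x U \<le> ?S" using s by simp
      qed
    qed
  qed
qed

lemma approximant_vals_directed:
  fixes x :: "nat \<Rightarrow> 'a::continuous_dcpo"
  shows "directed_set (\<le>) ((\<lambda>e. term_val (KScale (fst e) t) (snd e)) ` approximants x)"
  using approximants_directed
proof (rule directed_set_image)
  fix e e' assume e: "e \<in> approximants x" "e' \<in> approximants x" "prod_le (\<le>) (\<le>) e e'"
  then have "term_val t (snd e) \<le> term_val t (snd e')"
    by (intro term_val_mono) (auto simp: prod_le_def le_fun_def)
  moreover have "ennreal (fst e) \<le> ennreal (fst e')"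
    using e by (auto simp: prod_le_def intro: ennreal_leI)
  ultimately show "term_val (KScale (fst e) t) (snd e) \<le> term_val (KScale (fst e') t) (snd e')"
    by (auto simp: le_fun_def intro: mult_mono)
qed

text \<open>Collects representing pairs rather than valuations, because evaluation in another
  kegelspitze acts on pairs.\<close>

definition gens_below :: "('a::order set \<Rightarrow> ennreal) \<Rightarrow> (kterm \<times> (nat \<Rightarrow> 'a)) set" where
  "gens_below \<mu> = {p \<in> gens. val_way_below (gen_val p) \<mu>}"

text \<open>\<open>D'\<close> refines \<open>D\<close> by the approximants of its members. Two
  elements of \<open>D'\<close> are way below members of \<open>D\<close>, hence way below one
  common \<open>d\<close> in \<open>D\<close>, whose own approximants are directed with supremum
  \<open>d\<close>; so \<open>D'\<close> is directed. Every generator way below \<open>\<mu>\<close>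
  lies below an element of \<open>D'\<close>, and \<open>D'\<close> consists of such generators, so
  directedness carries over to all of them.\<close>

lemma gens_below_basis:
  fixes \<mu> :: "'a::continuous_dcpo set \<Rightarrow> ennreal"
  assumes "\<mu> \<in> consistent_vals"
  shows "directed_set (\<le>) (gen_val ` gens_below \<mu>) \<and> Sup (gen_val ` gens_below \<mu>) = \<mu>"
proof -
  let ?B = "gen_val ` gens_below \<mu>"
  obtain D where D: "D \<subseteq> gen_val ` gens" "directed_set (\<le>) D" "\<mu> = Sup D"
    using assms unfolding consistent_vals_eq by blast
  have sub: "D \<subseteq> subprob_vals" using D(1) gen_val_subprob by blast
  define D' where "D' = {term_val (KScale (fst e) t) (snd e) | t x e.
      (t, x) \<in> gens \<and> term_val t x \<in> D \<and> e \<in> approximants x}"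
  have D'_B: "D' \<subseteq> ?B"
  proof
    fix \<nu> assume "\<nu> \<in> D'"
    then obtain t x e where \<nu>: "\<nu> = term_val (KScale (fst e) t) (snd e)"
      and tx: "(t, x) \<in> gens" "term_val t x \<in> D" and e: "e \<in> approximants x"
      unfolding D'_def by blast
    have "term_val t x \<le> \<mu>" unfolding D(3) using tx(2) by (rule Sup_upper)
    moreover have "wf_term t" using tx(1) by (simp add: gens_def)
    ultimately have "(KScale (fst e) t, snd e) \<in> gens_below \<mu>"
      using approximant_gen[OF tx(1) e] approximant_way_below[OF _ e] val_way_below_le_trans
      unfolding gens_below_def by auto
    from imageI[OF this, of gen_val] show "\<nu> \<in> ?B" unfolding \<nu> by simp
  qed
  have subD': "D' \<subseteq> subprob_vals" using D'_B gen_vals_subprob unfolding gens_below_def by blast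
  have ub: "\<nu> \<le> \<mu>" if "\<nu> \<in> ?B" for \<nu>
  proof -
    have "val_way_below \<nu> \<mu>" using that by (auto simp: gens_below_def)
    from val_way_belowD[OF this sub D(2)] D(3) obtain d where "d \<in> D" "\<nu> \<le> d" by auto
    then show ?thesis unfolding D(3) by (meson Sup_upper order_trans)
  qed
  have "d \<le> Sup D'" if "d \<in> D" for d
  proof -
    obtain t x where tx: "(t, x) \<in> gens" "d = term_val t x" using D(1) \<open>d \<in> D\<close> by fastforce
    then have "d = (SUP e\<in>approximants x. term_val (KScale (fst e) t) (snd e))"
      using approximants_Sup[of t x] tx(1) by (simp only: gens_def mem_Collect_eq fst_conv)
    also have "\<dots> \<le> Sup D'" using tx that unfolding D'_def by (intro Sup_subset_mono) blast
    finally show ?thesis .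
  qed
  then have \<mu>_le: "\<mu> \<le> Sup D'" unfolding D(3) by (rule Sup_least)
  also have "\<dots> \<le> Sup ?B" using D'_B by (rule Sup_subset_mono)
  finally have Sup: "Sup ?B = \<mu>" using ub by (intro antisym Sup_least)
  have dirD': "directed_set (\<le>) D'"
  proof (rule directed_setI)
    obtain d where d: "d \<in> D" using directed_set_nonempty[OF D(2)] by blast
    obtain t x where tx: "(t, x) \<in> gens" "d = term_val t x" using D(1) d by fastforce
    obtain e where "e \<in> approximants x" using directed_set_nonempty[OF approximants_directed] by blast
    then show "D' \<noteq> {}" using tx d unfolding D'_def by blast
  next
    fix \<nu> \<nu>' assume \<nu>: "\<nu> \<in> D'" "\<nu>' \<in> D'"
    have wb: "\<exists>d\<in>D. val_way_below \<nu> d" if "\<nu> \<in> D'" for \<nu>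
      using that approximant_way_below unfolding D'_def gens_def by fastforce
    obtain d1 d2 where d12: "d1 \<in> D" "val_way_below \<nu> d1" "d2 \<in> D" "val_way_below \<nu>' d2"
      using wb[OF \<nu>(1)] wb[OF \<nu>(2)] by blast
    obtain d where d: "d \<in> D" "d1 \<le> d" "d2 \<le> d" using directed_setD[OF D(2) d12(1,3)] by blast
    obtain t x where tx: "(t, x) \<in> gens" "d = term_val t x" using D(1) d by fastforce
    let ?M = "(\<lambda>e. term_val (KScale (fst e) t) (snd e)) ` approximants x"
    have M: "?M \<subseteq> D'" using tx d(1) unfolding D'_def by blast
    have dir: "directed_set (\<le>) ?M" by (rule approximant_vals_directed)
    have le: "d \<le> Sup ?M"
      using approximants_Sup[of t x] tx by (simp only: gens_def mem_Collect_eq fst_conv order_refl)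
    have subM: "?M \<subseteq> subprob_vals" using M subD' by (rule subset_trans)
    obtain m m' where m: "m \<in> ?M" "\<nu> \<le> m" "m' \<in> ?M" "\<nu>' \<le> m'"
      using val_way_belowD[OF val_way_below_le_trans[OF d12(2) d(2)] subM dir le]
        val_way_belowD[OF val_way_below_le_trans[OF d12(4) d(3)] subM dir le] by blast
    obtain k where "k \<in> ?M" "m \<le> k" "m' \<le> k" using directed_setD[OF dir m(1,3)] by blast
    then show "\<exists>k\<in>D'. \<nu> \<le> k \<and> \<nu>' \<le> k" using m M by (meson order_trans subsetD)
  qed
  have "directed_set (\<le>) ?B"
  proof (rule directed_setI)
    show "?B \<noteq> {}" using D'_B directed_set_nonempty[OF dirD'] by blast
  next
    fix \<nu> \<nu>' assume \<nu>: "\<nu> \<in> ?B" "\<nu>' \<in> ?B"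
    then have wb: "val_way_below \<nu> \<mu>" "val_way_below \<nu>' \<mu>" by (auto simp: gens_below_def)
    obtain m m' where m: "m \<in> D'" "\<nu> \<le> m" "m' \<in> D'" "\<nu>' \<le> m'"
      using val_way_belowD[OF wb(1) subD' dirD' \<mu>_le] val_way_belowD[OF wb(2) subD' dirD' \<mu>_le] by blast
    obtain k where "k \<in> D'" "m \<le> k" "m' \<le> k" using directed_setD[OF dirD' m(1,3)] by blast
    then show "\<exists>k\<in>?B. \<nu> \<le> k \<and> \<nu>' \<le> k"
      using m D'_B by (meson order_trans subsetD)
  qed
  with Sup show ?thesis by blast
qed

section \<open>The kegelspitze of consistent valuations\<close>

lemma gens_below_mono: "\<mu> \<le> \<mu>' \<Longrightarrow> gens_below \<mu> \<subseteq> gens_below \<mu>'"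
  unfolding gens_below_def using val_way_below_le_trans by blast

lemma gens_below_val_way_below: "p \<in> gens_below \<mu> \<Longrightarrow> val_way_below (gen_val p) \<mu>"
  unfolding gens_below_def by blast

lemma gens_below_gens: "p \<in> gens_below \<mu> \<Longrightarrow> p \<in> gens"
  unfolding gens_below_def by blast

lemma gens_below_subprob: "gen_val ` gens_below \<mu> \<subseteq> subprob_vals"
  using gen_vals_subprob gens_below_gens by blast

lemmas gens_below_directed = gens_below_basis[THEN conjunct1]
  and gens_below_Sup = gens_below_basis[THEN conjunct2]

text \<open>Joins of valuations are not at hand. This bound takes their place and, being a
  generator, also yields a Dirac valuation above both.\<close>

lemma gens_below_upper_bound:
  fixes \<mu> :: "'a::continuous_dcpo set \<Rightarrow> ennreal"
  assumes \<mu>: "\<mu> \<in> consistent_vals" and "val_way_below \<nu> \<mu>" "val_way_below \<nu>' \<mu>"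
  shows "\<exists>p\<in>gens_below \<mu>. \<nu> \<le> gen_val p \<and> \<nu>' \<le> gen_val p"
proof -
  let ?B = "gen_val ` gens_below \<mu>"
  have le: "\<mu> \<le> Sup ?B" using gens_below_Sup[OF \<mu>] by simp
  obtain m m' where m: "m \<in> ?B" "\<nu> \<le> m" "m' \<in> ?B" "\<nu>' \<le> m'"
    using val_way_belowD[OF assms(2) gens_below_subprob gens_below_directed[OF \<mu>] le]
      val_way_belowD[OF assms(3) gens_below_subprob gens_below_directed[OF \<mu>] le] by blast
  obtain k where "k \<in> ?B" "m \<le> k" "m' \<le> k"
    using directed_setD[OF gens_below_directed[OF \<mu>] m(1,3)] by blast
  then show ?thesis using m by (auto intro: order_trans)
qed

lemma gens_below_le:
  fixes \<mu> :: "'a::continuous_dcpo set \<Rightarrow> ennreal"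
  assumes "\<mu> \<in> consistent_vals" "p \<in> gens_below \<mu>"
  shows "gen_val p \<le> \<mu>"
  using SUP_upper[OF assms(2), of gen_val] gens_below_Sup[OF assms(1)] by simp

text \<open>The generators way below members of \<open>M\<close> are directed: two of them are way
  below one common member of \<open>M\<close>, which has a generator way below it that dominates
  both.\<close>

lemma consistent_vals_Sup:
  fixes M :: "('a::continuous_dcpo set \<Rightarrow> ennreal) set"
  assumes M: "M \<subseteq> consistent_vals" and dir: "directed_set (\<le>) M"
  shows "Sup M \<in> consistent_vals"
proof -
  let ?D = "\<Union>\<mu>\<in>M. gen_val ` gens_below \<mu>"
  have "directed_set (\<le>) ?D"
  proof (rule directed_setI)
    obtain \<mu> where \<mu>: "\<mu> \<in> M" using directed_set_nonempty[OF dir] by blast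
    then have "gen_val ` gens_below \<mu> \<noteq> {}"
      using M by (intro directed_set_nonempty[OF gens_below_directed]) auto
    then show "?D \<noteq> {}" using \<mu> by blast
  next
    fix \<nu> \<nu>' assume "\<nu> \<in> ?D" "\<nu>' \<in> ?D"
    then obtain \<mu> \<mu>' where \<mu>: "\<mu> \<in> M" "\<mu>' \<in> M" "val_way_below \<nu> \<mu>" "val_way_below \<nu>' \<mu>'"
      using gens_below_val_way_below by blast
    obtain \<kappa> where \<kappa>: "\<kappa> \<in> M" "\<mu> \<le> \<kappa>" "\<mu>' \<le> \<kappa>" using directed_setD[OF dir \<mu>(1,2)] by blast
    then obtain p where "p \<in> gens_below \<kappa>" "\<nu> \<le> gen_val p" "\<nu>' \<le> gen_val p"
      using gens_below_upper_bound[OF subsetD[OF M \<kappa>(1)] val_way_below_le_trans[OF \<mu>(3) \<kappa>(2)]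
          val_way_below_le_trans[OF \<mu>(4) \<kappa>(3)]] by blast
    then show "\<exists>k\<in>?D. \<nu> \<le> k \<and> \<nu>' \<le> k" using \<kappa>(1) by blast
  qed
  moreover have "Sup M = Sup ?D"
  proof (rule antisym)
    show "Sup M \<le> Sup ?D"
    proof (rule Sup_least)
      fix \<mu> assume \<mu>: "\<mu> \<in> M"
      then have "\<mu> = Sup (gen_val ` gens_below \<mu>)" using gens_below_Sup[OF subsetD[OF M \<mu>]] by simp
      also have "\<dots> \<le> Sup ?D" using \<mu> by (intro Sup_subset_mono) blast
      finally show "\<mu> \<le> Sup ?D" .
    qed
    show "Sup ?D \<le> Sup M"
    proof (rule Sup_least)
      fix \<nu> assume "\<nu> \<in> ?D"
      then obtain \<mu> where "\<mu> \<in> M" "\<nu> \<le> \<mu>" using gens_below_le M by blast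
      then show "\<nu> \<le> Sup M" by (rule Sup_upper2)
    qed
  qed
  moreover have "?D \<subseteq> gen_val ` gens" using gens_below_gens by blast
  ultimately show ?thesis unfolding consistent_vals_eq by blast
qed

lemma is_sup_consistent_vals_iff:
  fixes M :: "('a::continuous_dcpo set \<Rightarrow> ennreal) set"
  assumes "M \<subseteq> consistent_vals" "directed_set (\<le>) M"
  shows "is_sup consistent_vals (\<le>) M \<mu> \<longleftrightarrow> \<mu> = Sup M"
  using consistent_vals_Sup[OF assms] by (rule is_sup_Sup_iff)

lemma gens_below_is_sup:
  fixes \<mu> :: "'a::continuous_dcpo set \<Rightarrow> ennreal"
  assumes "\<mu> \<in> consistent_vals"
  shows "is_sup consistent_vals (\<le>) (gen_val ` gens_below \<mu>) \<mu>"
  using gens_below_Sup[OF assms] assms by (subst is_sup_Sup_iff) auto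

lemma gens_below_consistent: "gen_val ` gens_below \<mu> \<subseteq> consistent_vals"
  using gen_val_consistent gens_below_gens by blast

text \<open>Named forms of the operations of \<open>Vc\<close>, so that simplification leaves them
  folded.\<close>

definition val_plus :: "real \<Rightarrow> ('b \<Rightarrow> ennreal) \<Rightarrow> ('b \<Rightarrow> ennreal) \<Rightarrow> 'b \<Rightarrow> ennreal" where
  "val_plus r \<mu> \<nu> = (\<lambda>U. ennreal r * \<mu> U + ennreal (1 - r) * \<nu> U)"

definition val_scale :: "real \<Rightarrow> ('b \<Rightarrow> ennreal) \<Rightarrow> 'b \<Rightarrow> ennreal" where
  "val_scale r \<mu> = (\<lambda>U. ennreal r * \<mu> U)"

lemma Vc_simps [simp]:
  "kcarrier Vc = consistent_vals" "kle Vc = (\<le>)" "kzero Vc = (\<lambda>U. 0)"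
  "kplus Vc r = val_plus r" "kscale Vc r = val_scale r"
  by (simp_all add: Vc_def val_plus_def val_scale_def fun_eq_iff)

section \<open>Continuity of the operations and closure under them\<close>

lemma val_plus_mono: "\<mu> \<le> \<mu>' \<Longrightarrow> \<nu> \<le> \<nu>' \<Longrightarrow> val_plus r \<mu> \<nu> \<le> val_plus r \<mu>' \<nu>'"
  unfolding val_plus_def le_fun_def by (auto intro!: add_mono mult_left_mono)

lemma val_scale_mono: "r \<le> s \<Longrightarrow> \<mu> \<le> \<mu>' \<Longrightarrow> val_scale r \<mu> \<le> val_scale s \<mu>'"
  unfolding val_scale_def le_fun_def by (auto intro: mult_mono ennreal_leI)

lemma val_plus_Sup:
  assumes D: "directed_set (prod_le (\<le>) (\<le>)) D"
  shows "val_plus r (Sup (fst ` D)) (Sup (snd ` D)) = (SUP p\<in>D. val_plus r (fst p) (snd p))"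
proof
  fix U
  have "val_plus r (Sup (fst ` D)) (Sup (snd ` D)) U =
      (SUP p\<in>D. ennreal r * fst p U) + (SUP p\<in>D. ennreal (1 - r) * snd p U)"
    unfolding val_plus_def Sup_apply image_image by (simp only: SUP_mult_left_ennreal)
  also have "\<dots> = (SUP p\<in>D. ennreal r * fst p U + ennreal (1 - r) * snd p U)"
  proof (rule SUP_add_directed_ennreal[symmetric])
    fix p q assume "p \<in> D" "q \<in> D"
    then obtain k where k: "k \<in> D" "prod_le (\<le>) (\<le>) p k" "prod_le (\<le>) (\<le>) q k"
      using directed_setD[OF D] by blast
    then have "fst p U \<le> fst k U" "snd q U \<le> snd k U" by (auto simp: prod_le_def le_fun_def)
    then show "\<exists>k\<in>D. ennreal r * fst p U + ennreal (1 - r) * snd q U \<le>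
        ennreal r * fst k U + ennreal (1 - r) * snd k U"
      using k(1) by (intro bexI[of _ k] add_mono mult_left_mono) auto
  qed
  finally show "val_plus r (Sup (fst ` D)) (Sup (snd ` D)) U =
      (SUP p\<in>D. val_plus r (fst p) (snd p)) U"
    unfolding val_plus_def Sup_apply image_image .
qed

lemma val_scale_Sup:
  assumes D: "directed_set (prod_le (\<le>) (\<le>)) D"
    and r: "is_sup {0..1} (\<le>) (fst ` D) r"
  shows "val_scale r (Sup (snd ` D)) = (SUP p\<in>D. val_scale (fst p) (snd p))"
proof
  fix U
  \<comment> \<open>\<open>r\<close> is least only among upper bounds in \<open>{0..1}\<close>. The
    supremum in \<open>ennreal\<close> is either at least 1, hence above \<open>r\<close>, or a real
    number that is such an upper bound itself.\<close>
  have "ennreal r \<le> (SUP p\<in>D. ennreal (fst p))"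
  proof (cases "1 \<le> (SUP p\<in>D. ennreal (fst p))")
    case True
    have "ennreal r \<le> 1" using r by (simp add: is_sup_def)
    then show ?thesis using True by (rule order_trans)
  next
    case False
    then obtain c where c: "(SUP p\<in>D. ennreal (fst p)) = ennreal c" "0 \<le> c" "c \<le> 1"
      by (cases "SUP p\<in>D. ennreal (fst p)") auto
    have "fst p \<le> c" if "p \<in> D" for p
      using SUP_upper[OF that, of "\<lambda>p. ennreal (fst p)"] c by (simp add: ennreal_le_iff)
    then have "r \<le> c" using r c unfolding is_sup_def by auto
    then show ?thesis unfolding c by (rule ennreal_leI)
  qed
  then have "val_scale r (Sup (snd ` D)) U \<le> (SUP p\<in>D. ennreal (fst p)) * (SUP q\<in>D. snd q U)"
    unfolding val_scale_def Sup_apply image_image by (rule mult_right_mono) simp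
  also have "\<dots> = (SUP q\<in>D. SUP p\<in>D. ennreal (fst p) * snd q U)"
    by (simp only: SUP_mult_left_ennreal SUP_mult_right_ennreal)
  also have "\<dots> \<le> (SUP p\<in>D. val_scale (fst p) (snd p)) U"
  proof (intro SUP_least)
    fix q p assume "q \<in> D" "p \<in> D"
    then obtain k where k: "k \<in> D" "prod_le (\<le>) (\<le>) p k" "prod_le (\<le>) (\<le>) q k"
      using directed_setD[OF D] by blast
    then have "fst p \<le> fst k" "snd q U \<le> snd k U" by (auto simp: prod_le_def le_fun_def)
    then have "ennreal (fst p) * snd q U \<le> val_scale (fst k) (snd k) U"
      unfolding val_scale_def by (intro mult_mono ennreal_leI) auto
    then show "ennreal (fst p) * snd q U \<le> (SUP p\<in>D. val_scale (fst p) (snd p)) U"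
      unfolding Sup_apply image_image using k(1) by (rule SUP_upper2[rotated])
  qed
  finally have "val_scale r (Sup (snd ` D)) U \<le> (SUP p\<in>D. val_scale (fst p) (snd p)) U" .
  moreover have "(SUP p\<in>D. val_scale (fst p) (snd p)) U \<le> val_scale r (Sup (snd ` D)) U"
  proof -
    have "(SUP p\<in>D. val_scale (fst p) (snd p)) \<le> val_scale r (Sup (snd ` D))"
      using r unfolding is_sup_def by (intro SUP_least val_scale_mono) (auto intro: Sup_upper)
    then show ?thesis by (rule le_funD)
  qed
  ultimately show "val_scale r (Sup (snd ` D)) U = (SUP p\<in>D. val_scale (fst p) (snd p)) U"
    by (rule antisym)
qed

text \<open>Approximants of \<open>\<mu>\<close> and \<open>\<nu>\<close> are also way below
  \<open>\<kappa>\<close>, hence lie below one generator and one Dirac valuation. Over a common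
  environment their combination is again a generator, and continuity of \<open>val_plus\<close>
  gives the supremum.\<close>

lemma consistent_vals_plus:
  fixes \<mu> \<nu> \<kappa> :: "'a::continuous_dcpo set \<Rightarrow> ennreal"
  assumes r: "r \<in> {0..1}" and \<mu>: "\<mu> \<in> consistent_vals" and \<nu>: "\<nu> \<in> consistent_vals"
    and \<kappa>: "\<kappa> \<in> consistent_vals" "\<mu> \<le> \<kappa>" "\<nu> \<le> \<kappa>"
  shows "val_plus r \<mu> \<nu> \<in> consistent_vals"
proof -
  let ?D = "(gen_val ` gens_below \<mu>) \<times> (gen_val ` gens_below \<nu>)"
  let ?E = "(\<lambda>p. val_plus r (fst p) (snd p)) ` ?D"
  have D: "directed_set (prod_le (\<le>) (\<le>)) ?D"
    using gens_below_directed[OF \<mu>] gens_below_directed[OF \<nu>] by (rule directed_set_prod)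
  have "?E \<subseteq> gen_val ` gens"
  proof
    fix \<xi> assume "\<xi> \<in> ?E"
    then obtain p q where pq: "p \<in> gens_below \<mu>" "q \<in> gens_below \<nu>"
      and eq: "\<xi> = val_plus r (gen_val p) (gen_val q)" by auto
    have wb: "val_way_below (gen_val p) \<kappa>" "val_way_below (gen_val q) \<kappa>"
      using pq gens_below_mono[OF \<kappa>(2)] gens_below_mono[OF \<kappa>(3)] gens_below_val_way_below by blast+
    obtain g where g: "g \<in> gens_below \<kappa>" "gen_val p \<le> gen_val g" "gen_val q \<le> gen_val g"
      using gens_below_upper_bound[OF \<kappa>(1) wb] by blast
    obtain y where y: "gen_val g \<le> dirac y" using gen_val_le_dirac gens_below_gens[OF g(1)] by blast
    obtain t u x where t: "wf_term t" "wf_term u" "\<And>n. x n \<le> y"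
      "gen_val p = term_val t x" "gen_val q = term_val u x"
      using gens_common_env[OF gens_below_gens[OF pq(1)] order_trans[OF g(2) y]
          gens_below_gens[OF pq(2)] order_trans[OF g(3) y]] by blast
    then have "(KPlus r t u, x) \<in> gens" "\<xi> = gen_val (KPlus r t u, x)"
      using r eq by (auto simp: gens_def bdd_above_def val_plus_def)
    then show "\<xi> \<in> gen_val ` gens" by blast
  qed
  moreover have "directed_set (\<le>) ?E"
    using D by (rule directed_set_image) (auto simp: prod_le_def intro: val_plus_mono)
  moreover have "val_plus r \<mu> \<nu> = Sup ?E"
  proof -
    have "fst ` ?D = gen_val ` gens_below \<mu>" "snd ` ?D = gen_val ` gens_below \<nu>"
      using directed_set_nonempty[OF D] by auto
    then show ?thesis using val_plus_Sup[OF D, of r] gens_below_Sup[OF \<mu>] gens_below_Sup[OF \<nu>] by simp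
  qed
  ultimately show ?thesis unfolding consistent_vals_eq by blast
qed

lemma consistent_vals_zero: "(\<lambda>U. 0) \<in> consistent_vals"
  using gen_val_consistent[of "(KZero, \<lambda>_. undefined)"] by (auto simp: gens_def bdd_above_def)

lemma val_scale_eq_plus: "val_scale r \<mu> = val_plus r \<mu> (\<lambda>U. 0)"
  by (simp add: val_scale_def val_plus_def)

lemma consistent_vals_scale:
  fixes \<mu> :: "'a::continuous_dcpo set \<Rightarrow> ennreal"
  assumes "r \<in> {0..1}" "\<mu> \<in> consistent_vals"
  shows "val_scale r \<mu> \<in> consistent_vals"
  unfolding val_scale_eq_plus
  using assms(2) by (intro consistent_vals_plus[OF assms(1)] consistent_vals_zero) (auto simp: le_fun_def)

lemma keval_Vc_law: "kegel_law t u \<Longrightarrow> keval Vc \<rho> t = keval Vc \<rho> u"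
proof (induction rule: kegel_law.induct)
  case (plus_idem r x)
  then show ?case
    by (auto simp: val_plus_def simp flip: distrib_right ennreal_plus)
next
  case (plus_assoc r s x y z)
  let ?q = "(s - r * s) / (1 - r * s)"
  have q: "?q \<in> {0..1}" using assoc_coeff[OF plus_assoc] .
  \<comment> \<open>The coefficients are identified over the reals and then transferred, since
    subtraction in \<open>ennreal\<close> is truncated.\<close>
  have 1: "ennreal (1 - r * s) * ennreal ?q = ennreal s * ennreal (1 - r)"
  proof -
    have "(1 - r * s) * ?q = s - r * s" using plus_assoc(3) by simp
    also have "\<dots> = s * (1 - r)" by (simp add: algebra_simps)
    finally have "(1 - r * s) * ?q = s * (1 - r)" .
    moreover have "ennreal (1 - r * s) * ennreal ?q = ennreal ((1 - r * s) * ?q)"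
      using q plus_assoc(3) by (intro ennreal_mult[symmetric]) auto
    ultimately show ?thesis using plus_assoc by (simp only:) (auto intro: ennreal_mult)
  qed
  have "1 - ?q = (1 - s) / (1 - r * s)" using plus_assoc by (simp add: field_simps)
  then have 2: "ennreal (1 - r * s) * ennreal (1 - ?q) = ennreal (1 - s)"
    using plus_assoc by (simp flip: ennreal_mult)
  have "ennreal s * (ennreal r * a + ennreal (1 - r) * b) + ennreal (1 - s) * c =
      ennreal (r * s) * a + ennreal (1 - r * s) * (ennreal ?q * b + ennreal (1 - ?q) * c)" for a b c
  proof -
    have "ennreal (1 - r * s) * (ennreal ?q * b + ennreal (1 - ?q) * c) =
        ennreal s * ennreal (1 - r) * b + ennreal (1 - s) * c"
      by (simp only: distrib_left mult.assoc[symmetric] 1 2)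
    moreover have "ennreal (r * s) = ennreal s * ennreal r"
      using plus_assoc by (simp add: ennreal_mult mult.commute)
    ultimately show ?thesis by (simp add: distrib_left mult.assoc add.assoc)
  qed
  then show ?case by (simp add: val_plus_def)
next
  case (scale_plus r s x y)
  then show ?case by (simp add: val_plus_def val_scale_def distrib_left mult.left_commute)
qed (auto simp: val_plus_def val_scale_def add.commute ennreal_mult mult.assoc)

lemma keval_Vc_deducible: "deducible_le t u \<Longrightarrow> keval Vc \<rho> t \<le> keval Vc \<rho> u"
proof (induction rule: deducible_le.induct)
  case (trans t u v)
  from trans.IH show ?case by (rule order_trans)
next
  case (plus_mono r t t' u u')
  then show ?case by (simp add: val_plus_mono)
next
  case (scale_mono r s t t')
  then show ?case by (simp add: val_scale_mono)
qed (simp_all add: keval_Vc_law)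

theorem consistent_kegelspitze_Vc:
  "consistent_kegelspitze (Vc :: ('a::continuous_dcpo set \<Rightarrow> ennreal) kegelspitze)"
proof
  let ?V = "Vc :: ('a set \<Rightarrow> ennreal) kegelspitze"
  show "is_dcpo (kcarrier ?V) (kle ?V)"
    unfolding is_dcpo_def using is_sup_consistent_vals_iff
    by (auto simp: reflp_on_def transp_on_def antisymp_on_def)
  show "kzero ?V \<in> kcarrier ?V" using consistent_vals_zero by simp
  show closed: "kplus ?V r \<mu> \<nu> \<in> kcarrier ?V"
    if "r \<in> {0..1}" "consistent_pair ?V \<mu> \<nu>" for r \<mu> \<nu>
    using that consistent_vals_plus unfolding consistent_pair_def by auto
  show "partially_scott_continuous ?V (kplus ?V r)" if r: "r \<in> {0..1}" for r
    unfolding partially_scott_continuous_def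
  proof (intro allI impI)
    fix D \<mu> \<nu>
    assume cons: "D \<subseteq> {(a, b). consistent_pair ?V a b}"
      and "directed_set (prod_le (kle ?V) (kle ?V)) D"
      and sup: "is_sup (kcarrier ?V \<times> kcarrier ?V) (prod_le (kle ?V) (kle ?V)) D (\<mu>, \<nu>)"
      and "consistent_pair ?V \<mu> \<nu>"
    then have dir: "directed_set (prod_le (\<le>) (\<le>)) D" and \<mu>\<nu>: "val_plus r \<mu> \<nu> \<in> consistent_vals"
      using closed[OF r] by auto
    have sub: "fst ` D \<subseteq> consistent_vals" "snd ` D \<subseteq> consistent_vals"
      using cons unfolding consistent_pair_def by auto
    have "\<mu> = Sup (fst ` D)" "\<nu> = Sup (snd ` D)"
      using sup is_sup_consistent_vals_iff[OF sub(1) directed_set_fst[OF dir]]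
        is_sup_consistent_vals_iff[OF sub(2) directed_set_snd[OF dir]]
      by (simp_all add: is_sup_prod_iff)
    then have eq: "val_plus r \<mu> \<nu> = (SUP p\<in>D. val_plus r (fst p) (snd p))"
      using val_plus_Sup[OF dir] by simp
    then have "is_sup consistent_vals (\<le>) ((\<lambda>p. val_plus r (fst p) (snd p)) ` D) (val_plus r \<mu> \<nu>)"
      using \<mu>\<nu> by (subst is_sup_Sup_iff) auto
    then show "is_sup (kcarrier ?V) (kle ?V) ((\<lambda>(a, b). kplus ?V r a b) ` D) (kplus ?V r \<mu> \<nu>)"
      by (simp add: case_prod_unfold)
  qed
  show "scott_continuous ({0..1::real} \<times> kcarrier ?V) (prod_le (\<le>) (kle ?V)) (kcarrier ?V) (kle ?V)
      (\<lambda>(r, x). kscale ?V r x)"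
    unfolding scott_continuous_def
  proof (intro conjI allI impI)
    show "(\<lambda>(r, x). kscale ?V r x) \<in> {0..1} \<times> kcarrier ?V \<rightarrow> kcarrier ?V"
      by (auto intro!: consistent_vals_scale)
  next
    fix D s
    assume D: "D \<subseteq> {0..1::real} \<times> kcarrier ?V" and "directed_set (prod_le (\<le>) (kle ?V)) D"
      and "is_sup ({0..1::real} \<times> kcarrier ?V) (prod_le (\<le>) (kle ?V)) D s"
    moreover obtain r \<mu> where s: "s = (r, \<mu>)" by fastforce
    ultimately have dir: "directed_set (prod_le (\<le>) (\<le>)) D"
      and sup: "is_sup {0..1} (\<le>) (fst ` D) r" "is_sup consistent_vals (\<le>) (snd ` D) \<mu>"
      by (simp_all add: is_sup_prod_iff)
    have "snd ` D \<subseteq> consistent_vals" using D by auto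
    then have "\<mu> = Sup (snd ` D)"
      using sup(2) is_sup_consistent_vals_iff[OF _ directed_set_snd[OF dir]] by simp
    then have eq: "val_scale r \<mu> = (SUP p\<in>D. val_scale (fst p) (snd p))"
      using val_scale_Sup[OF dir sup(1)] by simp
    moreover have "val_scale r \<mu> \<in> consistent_vals"
      using sup unfolding is_sup_def by (intro consistent_vals_scale) auto
    ultimately have "is_sup consistent_vals (\<le>) ((\<lambda>p. val_scale (fst p) (snd p)) ` D) (val_scale r \<mu>)"
      by (subst is_sup_Sup_iff) auto
    then show "is_sup (kcarrier ?V) (kle ?V) ((\<lambda>(r, x). kscale ?V r x) ` D)
        ((\<lambda>(r, x). kscale ?V r x) s)"
      by (simp add: case_prod_unfold s)
  qed
  show "kle ?V (keval ?V \<rho> t) (keval ?V \<rho> u)" if "deducible_le t u" for \<rho> t u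
    using keval_Vc_deducible[OF that] by simp
qed

lemma scott_continuous_dirac:
  "scott_continuous UNIV (\<le>) consistent_vals (\<le>) (dirac :: 'a::continuous_dcpo \<Rightarrow> 'a set \<Rightarrow> ennreal)"
  unfolding scott_continuous_def
proof (intro conjI allI impI)
  show "(dirac :: 'a \<Rightarrow> _) \<in> UNIV \<rightarrow> consistent_vals" using dirac_consistent by blast
next
  fix D and s :: 'a assume D: "directed_set (\<le>) D" "is_sup UNIV (\<le>) D s"
  have "Sup (dirac ` D) = dirac s"
  proof (rule antisym)
    show "Sup (dirac ` D) \<le> dirac s"
      using D(2) by (intro SUP_least dirac_mono) (auto simp: is_sup_def)
    show "dirac s \<le> Sup (dirac ` D)"
    proof (rule le_funI)
      fix U
      show "dirac s U \<le> Sup (dirac ` D) U"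
      proof (cases "scott_open U \<and> s \<in> U")
        case True
        then obtain d where "d \<in> D" "d \<in> U" using scott_open_directed D by blast
        moreover have "dirac s U \<le> dirac d U" using True \<open>d \<in> U\<close> by (simp add: dirac_def)
        ultimately show ?thesis unfolding Sup_apply image_image by (intro SUP_upper2)
      next
        case False
        then have "dirac s U = 0" by (auto simp: dirac_def)
        then show ?thesis by (simp only: zero_le)
      qed
    qed
  qed
  then show "is_sup consistent_vals (\<le>) (dirac ` D) (dirac s)"
    using dirac_consistent by (subst is_sup_Sup_iff) auto
qed

section \<open>The universal property\<close>

locale domain_map = consistent_kegelspitze K for K :: "'k kegelspitze" +
  fixes f :: "'a::continuous_dcpo \<Rightarrow> 'k"
  assumes f: "scott_continuous UNIV (\<le>) (kcarrier K) (kle K) f"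
begin

text \<open>A priori this depends on the representing pair; \<open>ev_eq\<close> shows that it
  depends on the valuation alone.\<close>

definition ev :: "kterm \<times> (nat \<Rightarrow> 'a) \<Rightarrow> 'k" where
  "ev p = keval K (\<lambda>n. f (snd p n)) (fst p)"

lemma f_closed: "f x \<in> kcarrier K"
  using scott_continuous_closed[OF f] by simp

lemma f_mono: "x \<le> y \<Longrightarrow> kle K (f x) (f y)"
  using scott_continuous_mono[OF f] by (simp add: reflp_on_def)

lemma gens_bounded_env:
  assumes "p \<in> gens"
  obtains b where "bounded_env K (\<lambda>n. f (snd p n)) b"
proof -
  obtain y where "\<And>n. snd p n \<le> y" using assms unfolding gens_def bdd_above_def by auto
  then have "bounded_env K (\<lambda>n. f (snd p n)) (f y)"
    unfolding bounded_env_def using f_closed f_mono by blast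
  then show thesis by (rule that)
qed

lemma ev_closed:
  assumes "p \<in> gens"
  shows "ev p \<in> kcarrier K"
proof -
  obtain b where "bounded_env K (\<lambda>n. f (snd p n)) b" using gens_bounded_env[OF assms] .
  then show ?thesis unfolding ev_def using assms by (intro keval_closed) (auto simp: gens_def)
qed

lemma ev_mono:
  assumes p: "p \<in> gens" and q: "q \<in> gens" and le: "gen_val p \<le> gen_val q"
  shows "kle K (ev p) (ev q)"
proof -
  obtain t x u x' where pq: "p = (t, x)" "q = (u, x')" by (metis surj_pair)
  have wf: "wf_term t" "wf_term u" using p q unfolding gens_def pq by auto
  let ?I = "term_vars t" and ?J = "term_vars u"
  let ?R = "\<lambda>i j. x i \<le> x' j"
  have "sum (weight t) A \<le> sum (weight u) {j \<in> ?J. \<exists>i\<in>A. ?R i j}" if A: "A \<subseteq> ?I" for A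
  proof -
    \<comment> \<open>\<open>U\<close> avoids everything below a non-neighbour of \<open>A\<close>.
      It contains \<open>x i\<close> for each \<open>i\<close> in \<open>A\<close>, and
      \<open>x' j\<close> can lie in \<open>U\<close> only if \<open>j\<close> is a
      neighbour.\<close>
    define U where "U = (\<Inter>j\<in>{j \<in> ?J. \<not> (\<exists>i\<in>A. ?R i j)}. {z. \<not> z \<le> x' j})"
    have U: "scott_open U" unfolding U_def by (rule scott_open_INT) (simp_all add: scott_open_not_le)
    have "ennreal (\<Sum>i\<in>{i\<in>?I. x i \<in> U}. weight t i) = term_val t x U"
      using term_val_open_eq[OF finite_term_vars wf(1) subset_refl U] by simp
    also have "\<dots> \<le> term_val u x' U" using le unfolding pq by (simp add: le_funD)
    also have "\<dots> = ennreal (\<Sum>j\<in>{j\<in>?J. x' j \<in> U}. weight u j)"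
      using term_val_open_eq[OF finite_term_vars wf(2) subset_refl U] by simp
    finally have le_U: "(\<Sum>i\<in>{i\<in>?I. x i \<in> U}. weight t i) \<le> (\<Sum>j\<in>{j\<in>?J. x' j \<in> U}. weight u j)"
      by (simp add: ennreal_le_iff sum_nonneg weight_nonneg[OF wf(2)])
    have "sum (weight t) A \<le> (\<Sum>i\<in>{i\<in>?I. x i \<in> U}. weight t i)"
      using A weight_nonneg[OF wf(1)] by (intro sum_mono2) (auto simp: U_def)
    also have "\<dots> \<le> (\<Sum>j\<in>{j\<in>?J. x' j \<in> U}. weight u j)" by (rule le_U)
    also have "\<dots> \<le> sum (weight u) {j \<in> ?J. \<exists>i\<in>A. ?R i j}"
      using weight_nonneg[OF wf(2)] by (intro sum_mono2) (auto simp: U_def)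
    finally show ?thesis .
  qed
  then obtain \<tau> where \<tau>: "\<forall>i j. 0 \<le> \<tau> i j \<and> (\<tau> i j \<noteq> 0 \<longrightarrow> i \<in> ?I \<and> j \<in> ?J \<and> ?R i j)"
    "\<forall>i\<in>?I. (\<Sum>j\<in>?J. \<tau> i j) = weight t i" "\<forall>j\<in>?J. (\<Sum>i\<in>?I. \<tau> i j) \<le> weight u j"
    using coupling_exists[of ?I ?J "weight t" "weight u" ?R] weight_nonneg wf by auto
  obtain b b' where b: "bounded_env K (\<lambda>n. f (x n)) b" "bounded_env K (\<lambda>n. f (x' n)) b'"
    using gens_bounded_env[OF p] gens_bounded_env[OF q] unfolding pq by (metis snd_conv)
  have "kle K (keval K (\<lambda>n. f (x n)) t) (keval K (\<lambda>n. f (x' n)) u)"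
  proof (rule keval_le_of_coupling[OF b finite_term_vars finite_term_vars wf, where \<tau> = \<tau>])
    show "weight t i = 0" if "i \<notin> ?I" for i using that by (rule weight_not_var)
    show "0 \<le> \<tau> i j" for i j using \<tau>(1) by blast
    show "i \<in> ?I \<and> j \<in> ?J \<and> kle K (f (x i)) (f (x' j))" if "\<tau> i j \<noteq> 0" for i j
      using \<tau>(1) that f_mono by blast
  qed (use \<tau>(2,3) in auto)
  then show ?thesis unfolding pq ev_def by simp
qed

lemma ev_eq: "p \<in> gens \<Longrightarrow> q \<in> gens \<Longrightarrow> gen_val p = gen_val q \<Longrightarrow> ev p = ev q"
  by (intro kle_antisym ev_mono ev_closed) auto

text \<open>Term evaluation is continuous in the points, by \<open>keval_is_sup\<close>, and scaling
  is continuous jointly in scalar and element. The directed family of pairs has supremum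
  \<open>(1, ev (t, x))\<close>, and scaling by 1 is the identity.\<close>

lemma ev_approximants:
  assumes tx: "(t, x) \<in> gens"
  shows "is_sup (kcarrier K) (kle K) ((\<lambda>e. ev (KScale (fst e) t, snd e)) ` approximants x) (ev (t, x))"
proof -
  let ?E = "approximants x"
  let ?\<rho> = "\<lambda>e n. f (snd e n)"
  have wf: "wf_term t" using tx by (simp add: gens_def)
  obtain b where b: "bounded_env K (\<lambda>n. f (x n)) b" using gens_bounded_env[OF tx] by auto
  have sup_n: "is_sup (kcarrier K) (kle K) ((\<lambda>e. ?\<rho> e n) ` ?E) (f (x n))" for n
  proof -
    obtain e0 where e0: "e0 \<in> ?E" using directed_set_nonempty[OF approximants_directed] by blast
    \<comment> \<open>Coordinates vary independently: changing one coordinate of a fixed approximant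
      reaches every element way below \<open>x n\<close>.\<close>
    have "(\<lambda>e. snd e n) ` ?E = {y. way_below y (x n)}"
    proof (intro equalityI subsetI)
      fix y assume "y \<in> {y. way_below y (x n)}"
      then have "(fst e0, (snd e0)(n := y)) \<in> ?E" using e0 by (simp add: approximants_def)
      from imageI[OF this, of "\<lambda>e. snd e n"] show "y \<in> (\<lambda>e. snd e n) ` ?E" by simp
    qed (auto simp: approximants_def)
    then have "(\<lambda>e. ?\<rho> e n) ` ?E = f ` {y. way_below y (x n)}" by (metis image_image)
    then show ?thesis
      using scott_continuous_is_sup[OF f subset_UNIV directed_way_below sup_way_below] by simp
  qed
  have sup: "is_sup (kcarrier K) (kle K) ((\<lambda>e. keval K (?\<rho> e) t) ` ?E) (ev (t, x))"
    and mono: "\<forall>e\<in>?E. \<forall>e'\<in>?E. prod_le (\<le>) (\<le>) e e' \<longrightarrow> kle K (keval K (?\<rho> e) t) (keval K (?\<rho> e') t)"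
    using keval_is_sup[OF approximants_directed _ f_closed sup_n b wf] f_mono
    by (auto simp: prod_le_def le_fun_def ev_def)
  let ?D = "(\<lambda>e. (fst e, keval K (?\<rho> e) t)) ` ?E"
  have dir: "directed_set (prod_le (\<le>) (kle K)) ?D"
    using approximants_directed
    by (rule directed_set_image) (use mono in \<open>auto simp: prod_le_def\<close>)
  have closed: "keval K (?\<rho> e) t \<in> kcarrier K" if "e \<in> ?E" for e
    using ev_closed[OF approximant_gen[OF tx that]] gens_bounded_env[OF approximant_gen[OF tx that]]
      keval_closed[OF _ wf] by auto
  have "is_sup {0..1} (\<le>) (fst ` ?E) 1"
  proof -
    obtain e0 where e0: "e0 \<in> ?E" using directed_set_nonempty[OF approximants_directed] by blast
    have "fst ` ?E = {0..<1}"
    proof (intro equalityI subsetI)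
      fix s :: real assume "s \<in> {0..<1}"
      then have "(s, snd e0) \<in> ?E" using e0 by (simp add: approximants_def)
      from imageI[OF this, of fst] show "s \<in> fst ` ?E" by simp
    qed (auto simp: approximants_def)
    moreover have "1 \<le> u" if "\<forall>s\<in>{0..<1}. s \<le> u" for u :: real
      using that(1) by (intro dense_le_bounded[of 0 1]) auto
    ultimately show ?thesis unfolding is_sup_def by auto
  qed
  then have "is_sup ({0..1} \<times> kcarrier K) (prod_le (\<le>) (kle K)) ?D (1, ev (t, x))"
    using sup by (simp add: is_sup_prod_iff image_image)
  moreover have "?D \<subseteq> {0..1} \<times> kcarrier K" using closed by (auto simp: approximants_def)
  ultimately have "is_sup (kcarrier K) (kle K) ((\<lambda>p. kscale K (fst p) (snd p)) ` ?D) (kscale K 1 (ev (t, x)))"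
    using scale_is_sup[OF dir] by blast
  then show ?thesis using scale_one[OF ev_closed[OF tx]] by (simp add: image_image ev_def)
qed

section \<open>Extension to consistent valuations by directed suprema\<close>

lemma ev_directed:
  assumes "\<mu> \<in> consistent_vals"
  shows "directed_set (kle K) (ev ` gens_below \<mu>)"
proof (rule directed_setI)
  show "ev ` gens_below \<mu> \<noteq> {}"
    using directed_set_nonempty[OF gens_below_directed[OF assms]] by blast
  fix k k' assume "k \<in> ev ` gens_below \<mu>" "k' \<in> ev ` gens_below \<mu>"
  then obtain p q where pq: "p \<in> gens_below \<mu>" "k = ev p" "q \<in> gens_below \<mu>" "k' = ev q" by blast
  obtain g where "g \<in> gens_below \<mu>" "gen_val p \<le> gen_val g" "gen_val q \<le> gen_val g"
    using gens_below_upper_bound[OF assms gens_below_val_way_below[OF pq(1)] gens_below_val_way_below[OF pq(3)]]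
    by blast
  then show "\<exists>z\<in>ev ` gens_below \<mu>. kle K k z \<and> kle K k' z"
    using pq ev_mono gens_below_gens by blast
qed

text \<open>Restricted to the carrier so that the result is extensional, the normal form in which
  homomorphisms are compared.\<close>

definition ext :: "('a set \<Rightarrow> ennreal) \<Rightarrow> 'k" where
  "ext = (\<lambda>\<mu>\<in>consistent_vals. SOME k. is_sup (kcarrier K) (kle K) (ev ` gens_below \<mu>) k)"

lemma ev_gens_below_closed: "ev ` gens_below \<mu> \<subseteq> kcarrier K"
  using ev_closed gens_below_gens by blast

lemma ext_is_sup:
  assumes "\<mu> \<in> consistent_vals"
  shows "is_sup (kcarrier K) (kle K) (ev ` gens_below \<mu>) (ext \<mu>)"
  using someI_ex[OF sup_exists[OF ev_gens_below_closed ev_directed[OF assms]]] assms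
  by (simp add: ext_def)

lemma ext_closed: "\<mu> \<in> consistent_vals \<Longrightarrow> ext \<mu> \<in> kcarrier K"
  using ext_is_sup unfolding is_sup_def by blast

lemma ext_mono:
  assumes "\<mu> \<in> consistent_vals" "\<nu> \<in> consistent_vals" "\<mu> \<le> \<nu>"
  shows "kle K (ext \<mu>) (ext \<nu>)"
  using ext_is_sup[OF assms(1)] ext_is_sup[OF assms(2)] gens_below_mono[OF assms(3)]
  unfolding is_sup_def by blast

text \<open>\<open>ev p\<close> is an upper bound by monotonicity of \<open>ev\<close>. It is the
  least one because the scaled approximants of \<open>p\<close> belong to the family and already
  have supremum \<open>ev p\<close>.\<close>

lemma ext_gen_val:
  assumes p: "p \<in> gens"
  shows "ext (gen_val p) = ev p"
proof -
  note cv = gen_val_consistent[OF p]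
  obtain t x where tx: "p = (t, x)" by (metis surj_pair)
  have "is_sup (kcarrier K) (kle K) (ev ` gens_below (gen_val p)) (ev p)"
    unfolding is_sup_def
  proof (intro conjI ballI impI)
    show "ev p \<in> kcarrier K" using ev_closed[OF p] .
    show "kle K k (ev p)" if "k \<in> ev ` gens_below (gen_val p)" for k
      using that ev_mono[OF gens_below_gens p] gens_below_le[OF cv] by blast
    fix u assume u: "u \<in> kcarrier K" "\<forall>k\<in>ev ` gens_below (gen_val p). kle K k u"
    have "(KScale (fst e) t, snd e) \<in> gens_below (gen_val p)" if "e \<in> approximants x" for e
      using approximant_gen[OF p[unfolded tx] that] approximant_way_below[OF _ that] p
      unfolding gens_below_def tx by (auto simp: gens_def)
    then have "\<forall>k\<in>(\<lambda>e. ev (KScale (fst e) t, snd e)) ` approximants x. kle K k u"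
      using u(2) by blast
    then show "kle K (ev p) u"
      using ev_approximants[OF p[unfolded tx]] u(1) unfolding is_sup_def tx by blast
  qed
  with ext_is_sup[OF cv] show ?thesis by (rule sup_unique)
qed

lemma ext_scott_continuous:
  "scott_continuous consistent_vals (\<le>) (kcarrier K) (kle K) ext"
  unfolding scott_continuous_def
proof (intro conjI allI impI)
  show "ext \<in> consistent_vals \<rightarrow> kcarrier K" using ext_closed by blast
next
  fix M :: "('a set \<Rightarrow> ennreal) set" and \<mu>
  assume M: "M \<subseteq> consistent_vals" "directed_set (\<le>) M" and "is_sup consistent_vals (\<le>) M \<mu>"
  then have \<mu>: "\<mu> = Sup M" "\<mu> \<in> consistent_vals"
    using is_sup_consistent_vals_iff by (auto simp: is_sup_def)
  have sub: "M \<subseteq> subprob_vals" using M(1) consistent_vals_subprob by blast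
  show "is_sup (kcarrier K) (kle K) (ext ` M) (ext \<mu>)"
    unfolding is_sup_def
  proof (intro conjI ballI impI)
    show "ext \<mu> \<in> kcarrier K" using ext_closed[OF \<mu>(2)] .
    show "kle K k (ext \<mu>)" if "k \<in> ext ` M" for k
      using that M(1) \<mu> ext_mono by (auto intro: Sup_upper)
    fix u assume u: "u \<in> kcarrier K" "\<forall>k\<in>ext ` M. kle K k u"
    have "kle K (ev p) u" if p: "p \<in> gens_below \<mu>" for p
    proof -
      \<comment> \<open>Being way below turns an inequality with the supremum of \<open>M\<close>
        into one with a single member.\<close>
      obtain m where m: "m \<in> M" "gen_val p \<le> m"
        using val_way_belowD[OF gens_below_val_way_below[OF p] sub M(2)] \<mu>(1) by auto
      have pg: "p \<in> gens" using p by (rule gens_below_gens)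
      have mc: "m \<in> consistent_vals" using m(1) M(1) by blast
      have "kle K (ev p) (ext m)"
        using ext_mono[OF gen_val_consistent[OF pg] mc m(2)] ext_gen_val[OF pg] by simp
      moreover have "kle K (ext m) u" using u(2) m(1) by blast
      ultimately show ?thesis using kle_trans ev_closed[OF pg] ext_closed[OF mc] u(1) by blast
    qed
    then show "kle K (ext \<mu>) u" using ext_is_sup[OF \<mu>(2)] u(1) unfolding is_sup_def by blast
  qed
qed

section \<open>The homomorphism property and uniqueness\<close>

lemma ext_dirac: "ext (dirac x) = f x"
proof -
  have "(KVar 0, \<lambda>_. x) \<in> gens" by (auto simp: gens_def bdd_above_def)
  from ext_gen_val[OF this] show ?thesis by (simp add: ev_def)
qed

lemma ext_zero: "ext (\<lambda>U. 0) = kzero K"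
proof -
  have "(KZero, \<lambda>_. undefined) \<in> gens" by (auto simp: gens_def bdd_above_def)
  from ext_gen_val[OF this] show ?thesis by (simp add: ev_def)
qed

interpretation V: consistent_kegelspitze "Vc :: ('a set \<Rightarrow> ennreal) kegelspitze"
  by (rule consistent_kegelspitze_Vc)

text \<open>Both sides are suprema of the same family \<open>kscale K r (ev p)\<close> with
  \<open>p\<close> in \<open>gens_below \<mu>\<close>: the left one by continuity of scaling in
  \<open>Vc\<close> and of \<open>ext\<close>, the right one by continuity of scaling in
  \<open>K\<close>.\<close>

lemma ext_scale:
  assumes r: "r \<in> {0..1}" and \<mu>: "\<mu> \<in> consistent_vals"
  shows "ext (val_scale r \<mu>) = kscale K r (ext \<mu>)"
proof -
  let ?B = "gen_val ` gens_below \<mu>"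
  have gen: "ext (val_scale r (gen_val p)) = kscale K r (ev p)" if p: "p \<in> gens_below \<mu>" for p
  proof -
    have "(KScale r (fst p), snd p) \<in> gens" using gens_below_gens[OF p] r by (simp add: gens_def)
    from ext_gen_val[OF this] show ?thesis by (simp add: ev_def val_scale_def)
  qed
  have "is_sup consistent_vals (\<le>) (val_scale r ` ?B) (val_scale r \<mu>)"
    by (rule V.scale_is_sup_right[unfolded Vc_simps, OF r gens_below_consistent
          gens_below_directed[OF \<mu>] gens_below_is_sup[OF \<mu>]])
  moreover have "directed_set (\<le>) (val_scale r ` ?B)"
    using gens_below_directed[OF \<mu>] by (rule directed_set_image) (simp add: val_scale_mono)
  moreover have "val_scale r ` ?B \<subseteq> consistent_vals"
    using consistent_vals_scale[OF r] gens_below_consistent by blast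
  ultimately have "is_sup (kcarrier K) (kle K) (ext ` val_scale r ` ?B) (ext (val_scale r \<mu>))"
    using scott_continuous_is_sup[OF ext_scott_continuous] by blast
  moreover have "ext ` val_scale r ` ?B = kscale K r ` ev ` gens_below \<mu>"
    unfolding image_image using gen by (rule image_cong[OF HOL.refl])
  moreover have "is_sup (kcarrier K) (kle K) (kscale K r ` ev ` gens_below \<mu>) (kscale K r (ext \<mu>))"
    by (rule scale_is_sup_right[OF r ev_gens_below_closed ev_directed[OF \<mu>] ext_is_sup[OF \<mu>]])
  ultimately show ?thesis using sup_unique by simp
qed

text \<open>\<open>ev_eq\<close> permits passing to representations of \<open>p\<close> and
  \<open>q\<close> over one environment, where the combination of the valuations is the value of a
  single term.\<close>

lemma ext_plus_gen_val:
  assumes r: "r \<in> {0..1}" and p: "p \<in> gens" "gen_val p \<le> dirac y" and q: "q \<in> gens" "gen_val q \<le> dirac y"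
  shows "ext (val_plus r (gen_val p) (gen_val q)) = kplus K r (ev p) (ev q)"
proof -
  obtain t u x where t: "wf_term t" "wf_term u" "\<And>n. x n \<le> y"
    and eq: "gen_val p = term_val t x" "gen_val q = term_val u x"
    using gens_common_env[OF p q] by blast
  have gens: "(t, x) \<in> gens" "(u, x) \<in> gens" "(KPlus r t u, x) \<in> gens"
    using t r by (auto simp: gens_def bdd_above_def)
  have "ev p = ev (t, x)" "ev q = ev (u, x)"
    using ev_eq[OF p(1) gens(1)] ev_eq[OF q(1) gens(2)] eq by auto
  moreover have "val_plus r (gen_val p) (gen_val q) = gen_val (KPlus r t u, x)"
    by (simp add: eq val_plus_def)
  ultimately show ?thesis using ext_gen_val[OF gens(3)] by (simp add: ev_def)
qed

text \<open>As for scaling, two suprema of one family, now indexed by pairs of approximants. The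
  bound \<open>\<kappa>\<close> puts each pair below a common Dirac valuation, so that the case of
  generators applies, and it makes \<open>ext \<mu>\<close> and \<open>ext \<nu>\<close> a
  consistent pair.\<close>

lemma ext_plus:
  assumes r: "r \<in> {0..1}" and \<mu>: "\<mu> \<in> consistent_vals" and \<nu>: "\<nu> \<in> consistent_vals"
    and \<kappa>: "\<kappa> \<in> consistent_vals" "\<mu> \<le> \<kappa>" "\<nu> \<le> \<kappa>"
  shows "ext (val_plus r \<mu> \<nu>) = kplus K r (ext \<mu>) (ext \<nu>)"
proof -
  let ?A = "gen_val ` gens_below \<mu>" and ?B = "gen_val ` gens_below \<nu>"
  let ?G = "gens_below \<mu> \<times> gens_below \<nu>"
  let ?P = "\<lambda>p. val_plus r (fst p) (snd p)"
  have gen: "ext (val_plus r (gen_val p) (gen_val q)) = kplus K r (ev p) (ev q)"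
    if pq: "p \<in> gens_below \<mu>" "q \<in> gens_below \<nu>" for p q
  proof -
    have wb: "val_way_below (gen_val p) \<kappa>" "val_way_below (gen_val q) \<kappa>"
      using pq gens_below_mono[OF \<kappa>(2)] gens_below_mono[OF \<kappa>(3)] gens_below_val_way_below by blast+
    obtain g where g: "g \<in> gens_below \<kappa>" "gen_val p \<le> gen_val g" "gen_val q \<le> gen_val g"
      using gens_below_upper_bound[OF \<kappa>(1) wb] by blast
    obtain y where y: "gen_val g \<le> dirac y" using gen_val_le_dirac gens_below_gens[OF g(1)] by blast
    show ?thesis
      using ext_plus_gen_val[OF r gens_below_gens[OF pq(1)] order_trans[OF g(2) y]
          gens_below_gens[OF pq(2)] order_trans[OF g(3) y]] .
  qed
  have cons: "consistent_pair Vc \<mu> \<nu>" using \<mu> \<nu> \<kappa> by (intro V.consistent_pairI[of _ _ \<kappa>]) auto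
  have sup: "is_sup consistent_vals (\<le>) (?P ` (?A \<times> ?B)) (val_plus r \<mu> \<nu>)"
    by (rule V.plus_is_sup_prod[unfolded Vc_simps, OF r gens_below_directed[OF \<mu>]
          gens_below_is_sup[OF \<mu>] gens_below_directed[OF \<nu>] gens_below_is_sup[OF \<nu>]
          gens_below_consistent gens_below_consistent cons])
  have dir: "directed_set (\<le>) (?P ` (?A \<times> ?B))"
    using directed_set_prod[OF gens_below_directed[OF \<mu>] gens_below_directed[OF \<nu>]]
    by (rule directed_set_image) (auto simp: prod_le_def intro: val_plus_mono)
  have sub: "?P ` (?A \<times> ?B) \<subseteq> consistent_vals"
  proof
    fix \<xi> assume "\<xi> \<in> ?P ` (?A \<times> ?B)"
    then obtain p where p: "p \<in> ?A \<times> ?B" and \<xi>: "\<xi> = ?P p" by blast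
    have "fst p \<in> ?A" "snd p \<in> ?B" using p by (simp_all only: mem_Times_iff)
    then have p: "fst p \<in> consistent_vals" "fst p \<le> \<mu>" "snd p \<in> consistent_vals" "snd p \<le> \<nu>"
      using gens_below_consistent gens_below_is_sup[OF \<mu>] gens_below_is_sup[OF \<nu>]
      unfolding is_sup_def by blast+
    then show "\<xi> \<in> consistent_vals"
      unfolding \<xi> using \<kappa> by (intro consistent_vals_plus[OF r, of _ _ \<kappa>]) auto
  qed
  have "is_sup (kcarrier K) (kle K) (ext ` ?P ` (?A \<times> ?B)) (ext (val_plus r \<mu> \<nu>))"
    using scott_continuous_is_sup[OF ext_scott_continuous sub dir sup] .
  moreover have "?A \<times> ?B = map_prod gen_val gen_val ` ?G" by (simp add: map_prod_surj_on)
  then have "ext ` ?P ` (?A \<times> ?B) = (\<lambda>p. kplus K r (fst p) (snd p)) ` map_prod ev ev ` ?G"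
    unfolding image_image by (simp only: image_image) (rule image_cong; simp add: gen mem_Times_iff)
  moreover have "map_prod ev ev ` ?G = ev ` gens_below \<mu> \<times> ev ` gens_below \<nu>"
    by (simp add: map_prod_surj_on)
  moreover have "consistent_pair K (ext \<mu>) (ext \<nu>)"
    using consistent_pairI[OF ext_closed[OF \<mu>] ext_closed[OF \<nu>] ext_closed[OF \<kappa>(1)]
        ext_mono[OF \<mu> \<kappa>(1,2)] ext_mono[OF \<nu> \<kappa>(1,3)]] .
  then have "is_sup (kcarrier K) (kle K)
      ((\<lambda>p. kplus K r (fst p) (snd p)) ` (ev ` gens_below \<mu> \<times> ev ` gens_below \<nu>))
      (kplus K r (ext \<mu>) (ext \<nu>))"
    by (intro plus_is_sup_prod r ev_directed ext_is_sup ev_gens_below_closed \<mu> \<nu>)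
  ultimately show ?thesis using sup_unique by simp
qed

lemma ext_hom: "kegelspitze_hom Vc K ext"
  unfolding kegelspitze_hom_def
  using ext_scott_continuous ext_zero ext_scale ext_plus by (auto simp: consistent_pair_def)

text \<open>On a generator, \<open>h\<close> is determined by induction on the term: all
  intermediate values lie below \<open>dirac y\<close>, so each sum that occurs is one that
  \<open>h\<close> preserves. Continuity determines \<open>h\<close> on the directed suprema of
  generators.\<close>

lemma hom_unique:
  assumes h: "kegelspitze_hom Vc K h" and dirac: "\<And>x. h (dirac x) = f x" and \<mu>: "\<mu> \<in> consistent_vals"
  shows "h \<mu> = ext \<mu>"
proof -
  have gen: "h (gen_val p) = ev p" if p: "p \<in> gens" for p
  proof -
    obtain y where y: "\<And>n. snd p n \<le> y" using p unfolding gens_def bdd_above_def by auto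
    have env: "bounded_env Vc (\<lambda>n. dirac (snd p n)) (dirac y)"
      unfolding bounded_env_def by (simp add: dirac_consistent dirac_mono y)
    have "wf_term t \<Longrightarrow> h (keval Vc (\<lambda>n. dirac (snd p n)) t) = keval K (\<lambda>n. f (snd p n)) t" for t
    proof (induction t)
      case (KVar n)
      then show ?case by (simp add: dirac)
    next
      case KZero
      then show ?case using h by (simp add: kegelspitze_hom_def)
    next
      case (KPlus r t u)
      then show ?case
        using h V.keval_consistent[OF env, of t u] by (simp add: kegelspitze_hom_def)
    next
      case (KScale r t)
      then show ?case
        using h V.keval_closed[OF env, of t] by (simp add: kegelspitze_hom_def)
    qed
    then show ?thesis using p unfolding ev_def term_val_def gens_def by simp
  qed
  have "scott_continuous consistent_vals (\<le>) (kcarrier K) (kle K) h"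
    using h by (simp add: kegelspitze_hom_def)
  from scott_continuous_is_sup[OF this gens_below_consistent gens_below_directed[OF \<mu>] gens_below_is_sup[OF \<mu>]]
  have "is_sup (kcarrier K) (kle K) (h ` gen_val ` gens_below \<mu>) (h \<mu>)" .
  moreover have "h ` gen_val ` gens_below \<mu> = ev ` gens_below \<mu>"
    unfolding image_image by (rule image_cong[OF HOL.refl]) (rule gen[OF gens_below_gens])
  ultimately show ?thesis using ext_is_sup[OF \<mu>] sup_unique by simp
qed

end

text \<open>A homomorphism is determined on the carrier only; \<open>extensional\<close> fixes the
  values of the total function elsewhere, so that uniqueness can be stated as equality of
  functions.\<close>

theorem theorem5p12:
  shows "consistent_kegelspitze (Vc :: ('a::continuous_dcpo set \<Rightarrow> ennreal) kegelspitze) \<and>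
    scott_continuous UNIV (\<le>) (kcarrier Vc) (kle Vc) (dirac :: 'a \<Rightarrow> 'a set \<Rightarrow> ennreal) \<and>
    (\<forall>(K :: 'k kegelspitze) (f :: 'a \<Rightarrow> 'k).
       consistent_kegelspitze K \<longrightarrow>
       scott_continuous UNIV (\<le>) (kcarrier K) (kle K) f \<longrightarrow>
       (\<exists>!h. h \<in> extensional (kcarrier Vc) \<and> kegelspitze_hom Vc K h \<and> (\<forall>x. h (dirac x) = f x)))"
proof (intro conjI allI impI)
  show "consistent_kegelspitze (Vc :: ('a set \<Rightarrow> ennreal) kegelspitze)"
    by (rule consistent_kegelspitze_Vc)
  show "scott_continuous UNIV (\<le>) (kcarrier Vc) (kle Vc) (dirac :: 'a \<Rightarrow> 'a set \<Rightarrow> ennreal)"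
    using scott_continuous_dirac by simp
next
  fix K :: "'k kegelspitze" and f :: "'a \<Rightarrow> 'k"
  assume "consistent_kegelspitze K" "scott_continuous UNIV (\<le>) (kcarrier K) (kle K) f"
  then interpret domain_map K f
    by (intro domain_map.intro domain_map_axioms.intro)
  show "\<exists>!h. h \<in> extensional (kcarrier Vc) \<and> kegelspitze_hom Vc K h \<and> (\<forall>x. h (dirac x) = f x)"
  proof (rule ex1I)
    show "ext \<in> extensional (kcarrier Vc) \<and> kegelspitze_hom Vc K ext \<and> (\<forall>x. ext (dirac x) = f x)"
      using ext_hom ext_dirac by (simp add: ext_def)
    fix h assume h: "h \<in> extensional (kcarrier Vc) \<and> kegelspitze_hom Vc K h \<and> (\<forall>x. h (dirac x) = f x)"
    show "h = ext"
    proof (rule extensionalityI)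
      show "h \<in> extensional consistent_vals" using h by simp
      show "ext \<in> extensional consistent_vals" by (simp add: ext_def)
      show "h \<mu> = ext \<mu>" if "\<mu> \<in> consistent_vals" for \<mu> using hom_unique[OF _ _ that] h by blast
    qed
  qed
qed

end
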